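(* Consider the problem $\min_{x\in\mathbb{R}^n} f(x)+r(x)$ with $r(x)=\sum_{i=1}^{n_{\mathcal G}}\lambda_i\|[x]_{\mathcal G_i}\|_2$, and let Algorithm A (described in the context) be run from $x_0$, producing infinite sequences $\{x_k\},\{\alpha_k\},\{\chi^{\mathrm{cg}}_k\},\{\chi^{\mathrm{pg}}_k\}$. Suppose: (1) $f$ is convex and continuously differentiable; on $\mathcal L:=\{x: f(x)+r(x)\le f(x_0)+r(x_0)\}$ the gradient $\nabla f$ is bounded in norm by a constant $L_f$ and Lipschitz continuous with constant $L$; $f+r$ is bounded below; (2) $\max\{\chi^{\mathrm{cg}}_k,\chi^{\mathrm{pg}}_k\}>0$ for all $k\in\mathbb N$; (3) there are constants $0<\mu_{\min}\le\mu_{\max}<\infty$ with $\mu_{\min}\|v\|_2^2\le v^TH_kv\le\mu_{\max}\|v\|_2^2$ for all $k\in\mathcal K^{\mathrm{cg}}$ and $v\in\mathbb{R}^{|\mathcal I_k|}$; (4) $f$ is twice continuously differentiable and strongly convex, so the problem has a unique solution $x_*$; with $\mathcal S_*:=\{i:[x_*]_{\mathcal G_i}\ne0\}$, $\nabla^2f$ is Lipschitz continuous in a neighborhood of $x_*$ and $\|[\nabla f(x_* )]_{\mathcal G_i}\|_2<\lambda_i$ for all $i\notin\mathcal S_*$; (5) $\eta\in(0,1/2)$; for all sufficiently large $k$, $\mathcal I_k=\mathcal I^{\mathrm{cg}}_k$ if $k\in\mathcal K^{\mathrm{cg}}$ and $\mathcal I_k=\mathcal I^{\mathrm{pg}}_k$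 if $k\in\mathcal K^{\mathrm{pg}}$; and for all sufficiently large $k\in\mathcal K^{\mathrm{cg}}$, $H_k=\nabla^2_{\mathcal I_k\mathcal I_k}(f+r)(x_k)$. Then $$\lim_{k\to\infty}x_k=x_*\quad\text{and}\quad\lim_{k\to\infty}\max\{\chi^{\mathrm{pg}}_k,\chi^{\mathrm{cg}}_k\}=0.$$
   Context: Notation. $\mathbb N=\{0,1,2,\dots\}$. The groups $\mathcal G_1,\dots,\mathcal G_{n_{\mathcal G}}$ form a partition of $\{1,\dots,n\}$, and $\lambda_i>0$. $[x]_{\mathcal I}$ is the subvector of $x$ indexed by $\mathcal I$ (with $\|[\cdot]_\emptyset\|_2=0$); $P_{\mathcal I}(x)\in\mathbb R^n$ agrees with $x$ on $\mathcal I$ and is $0$ elsewhere; $\nabla_{\mathcal I}$, $\nabla^2_{\mathcal I\mathcal I}$ are the gradient and Hessian with respect to the variables in $\mathcal I$. $F:=f+r$ is differentiable with respect to the variables of $\mathcal G_i$ wherever $[x]_{\mathcal G_i}\ne0$. The proximal gradient (PG) update is $T(x,\alpha):=\arg\min_{y}\{\frac1{2\alpha}\|y-(x-\alpha\nabla f(x))\|_2^2+r(y)\}$ and the PG step is $s(x,\alpha):=T(x,\alpha)-x$. Algorithm A. Constants: $\varphi,\xi,\eta,\zeta\in(0,1)$, $\kappa_1,\kappa_2,p\in(0,\infty)$, $\theta\in(0,\pi/2)$, $q\in[1,2]$; initial $x_0\in\mathbb R^n$, $\alpha_0\in(0,1]$. For $k=0,1,2,\dots$: 1. $s_k:=s(x_k,\alpha_k)$.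 2. $\bar{\mathcal I}^{\mathrm{cg}}_k$ := union of all $\mathcal G_i$ with $[x_k]_{\mathcal G_i}\ne0$, $[x_k+s_k]_{\mathcal G_i}\neq0$ and $\|[x_k]_{\mathcal G_i}\|_2\ge\kappa_1\|\nabla_{\mathcal G_i}F(x_k)\|_2$. $\mathcal I^{\mathrm{small}}_k$ := union of all $\mathcal G_i\subseteq\bar{\mathcal I}^{\mathrm{cg}}_k$ with $\|[x_k]_{\mathcal G_i}\|_2<\kappa_2\|\nabla_{\bar{\mathcal I}^{\mathrm{cg}}_k}F(x_k)\|_2^p$. $\mathcal I^{\mathrm{cg}}_k:=\bar{\mathcal I}^{\mathrm{cg}}_k\setminus\mathcal I^{\mathrm{small}}_k$, $\mathcal I^{\mathrm{pg}}_k:=\{1,\dots,n\}\setminus\mathcal I^{\mathrm{cg}}_k$, $\chi^{\mathrm{cg}}_k:=\|[s_k]_{\mathcal I^{\mathrm{cg}}_k}\|_2$, $\chi^{\mathrm{pg}}_k:=\|[s_k]_{\mathcal I^{\mathrm{pg}}_k}\|_2$. 3. If $\chi^{\mathrm{pg}}_k\le\chi^{\mathrm{cg}}_k$ (we write $k\in\mathcal K^{\mathrm{cg}}$): choose any $\mathcal I_k\subseteq\mathcal I^{\mathrm{cg}}_k$ that is a union of groups with $\|[s_k]_{\mathcal I_k}\|_2\ge\varphi\chi^{\mathrm{cg}}_k$; set $g_k:=\nabla_{\mathcal I_k}F(x_k)$; pick a symmetric positive-definite $H_k\in\mathbb R^{|\mathcal I_k|\times|\mathcal I_k|}$. CG direction: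 with $m_k(d):=g_k^Td+\frac12d^TH_kd$, $\beta_k:=\|g_k\|_2^2/(g_k^TH_kg_k)$, $d_k^R:=-\beta_kg_k$ and a chosen $\mu_k\in(0,1]$, compute any $\bar d_k$ with $g_k^T\bar d_k\le g_k^Td_k^R$, $m_k(\bar d_k)\le m_k(0)$, $\|H_k\bar d_k+g_k\|_2\le\mu_k\|g_k\|_2^q$. Set $[d_k]_{\mathcal I_k}:=\bar d_k$ and $d_k:=0$ elsewhere. CG search: for each $\mathcal G_i\subseteq\mathcal I_k$ let $\rho_{k,i}:=\max\{\kappa_1\|\nabla_{\mathcal G_i}F(x_k)\|_2,\kappa_2\|\nabla_{\mathcal I^{\mathrm{cg}}_k}F(x_k)\|_2^p\}$, $\bar\rho_{k,i}:=\min\{\rho_{k,i},\sin(\theta)\|[x_k]_{\mathcal G_i}\|_2\}$, and let $\tau_{k,i}$ be the smallest positive root $\tau$ of $\|[x_k+\tau d_k]_{\mathcal G_i}\|_2=\bar\rho_{k,i}$, or $\infty$ if the ray $\{[x_k+\tau d_k]_{\mathcal G_i}:\tau\ge0\}$ does not meet the closed ball of radius $\bar\rho_{k,i}$ about $0$; $\tau_k:=\min_i\tau_{k,i}$. For $j=0,1,2,\dots$ as long as $\xi^j\ge\tau_k$: let $y_j$ agree with $x_k$ outside $\mathcal I_k$, and for $\mathcal G_i\subseteq\mathcal I_k$ set $[y_j]_{\mathcal G_i}=[x_k+\xi^jd_k]_{\mathcal G_i}$ if $\xi^j<\tau_{k,i}$ and $[y_j]_{\mathcal G_i}=0$ if $\xi^j\ge\tau_{k,i}$;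 if $F(y_j)\le F(x_k)$, return $x_{k+1}:=y_j$ (then $k\in\mathcal K^{\mathrm{cg}}_0$). If this did not return, continue increasing $j$ (now $\xi^j<\tau_k$), with $y_j:=x_k+\xi^jd_k$, until $F(y_j)\le F(x_k)+\eta\xi^jg_k^T[d_k]_{\mathcal I_k}$, and return $x_{k+1}:=y_j$ (then $k\in\mathcal K^{\mathrm{cg}}_{\mathrm{sd}}$). Set $\alpha_{k+1}:=\alpha_k$. 4. Otherwise (we write $k\in\mathcal K^{\mathrm{pg}}$): choose any $\mathcal I_k\subseteq\mathcal I^{\mathrm{pg}}_k$ that is a union of groups with $\|[s_k]_{\mathcal I_k}\|_2\ge\varphi\chi^{\mathrm{pg}}_k$. PG search: let $j\ge0$ be the smallest integer such that $y_j:=x_k+\xi^jP_{\mathcal I_k}(s_k)$ satisfies $F(y_j)\le F(x_k)-\eta\xi^j\frac1{\alpha_k}\|P_{\mathcal I_k}(s_k)\|_2^2$; set $x_{k+1}:=y_j$. If $j=0$ (then $k\in\mathcal K^{\mathrm{pg}}_{\rightarrow}$) set $\alpha_{k+1}:=\alpha_k$; if $j>0$ (then $k\in\mathcal K^{\mathrm{pg}}_{\downarrow}$) set $\alpha_{k+1}:=\zeta\alpha_k$. *)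

theory Defs
  imports "HOL-Analysis.Analysis"
begin

section \<open>Subvectors, gradients and Hessians\<close>

text \<open>
  For an index set \<open>I\<close>, vectors in \<open>\<real>\<^bsup>|I|\<^esup>\<close> and \<open>|I| \<times> |I|\<close> matrices are represented by
  vectors and matrices over the full index type whose entries outside \<open>I\<close> (outside
  \<open>I \<times> I\<close>) vanish.  Thus \<open>proj I x\<close> plays the role both of the subvector of \<open>x\<close> indexed by \<open>I\<close>
  and of its zero extension; norms, inner products and matrix-vector products are unaffected.
\<close>

definition proj :: "'n set \<Rightarrow> real^'n \<Rightarrow> real^'n" where
  "proj I x = (\<chi> i. if i \<in> I then x $ i else 0)"

definition vec_on :: "'n set \<Rightarrow> real^'n \<Rightarrow> bool" where
  "vec_on I v \<longleftrightarrow> (\<forall>i. i \<notin> I \<longrightarrow> v $ i = 0)"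

definition mat_on :: "'n set \<Rightarrow> real^'n^'n \<Rightarrow> bool" where
  "mat_on I M \<longleftrightarrow> (\<forall>i j. i \<notin> I \<or> j \<notin> I \<longrightarrow> M $ i $ j = 0)"

definition sym_pos_def_on :: "'n::finite set \<Rightarrow> real^'n^'n \<Rightarrow> bool" where
  "sym_pos_def_on I M \<longleftrightarrow>
     mat_on I M \<and> transpose M = M \<and> (\<forall>v. vec_on I v \<and> v \<noteq> 0 \<longrightarrow> 0 < v \<bullet> (M *v v))"

definition gradient :: "(real^'n::finite \<Rightarrow> real) \<Rightarrow> real^'n \<Rightarrow> real^'n" where
  "gradient h x = (THE D. GDERIV h x :> D)"

definition hessian :: "(real^'n::finite \<Rightarrow> real) \<Rightarrow> real^'n \<Rightarrow> real^'n^'n" where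
  "hessian h x = matrix (frechet_derivative (gradient h) (at x))"

text \<open>
  Derivatives with respect to the variables in \<open>I\<close> only: since \<open>h (x + proj I u)\<close> does not
  depend on the components of \<open>u\<close> outside \<open>I\<close>, the results vanish outside \<open>I\<close>.
  Only differentiability in the variables of \<open>I\<close> is needed for them to be meaningful.
\<close>

definition partial_gradient ::
    "'n::finite set \<Rightarrow> (real^'n \<Rightarrow> real) \<Rightarrow> real^'n \<Rightarrow> real^'n" where
  "partial_gradient I h x = gradient (\<lambda>u. h (x + proj I u)) 0"

definition partial_hessian ::
    "'n::finite set \<Rightarrow> (real^'n \<Rightarrow> real) \<Rightarrow> real^'n \<Rightarrow> real^'n^'n" where
  "partial_hessian I h x = hessian (\<lambda>u. h (x + proj I u)) 0"

definition cont_differentiable :: "(real^'n::finite \<Rightarrow> real) \<Rightarrow> bool" where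
  "cont_differentiable h \<longleftrightarrow> (\<forall>x. h differentiable (at x)) \<and> continuous_on UNIV (gradient h)"

definition twice_cont_differentiable :: "(real^'n::finite \<Rightarrow> real) \<Rightarrow> bool" where
  "twice_cont_differentiable h \<longleftrightarrow>
     (\<forall>x. h differentiable (at x)) \<and> (\<forall>x. gradient h differentiable (at x)) \<and>
     continuous_on UNIV (hessian h)"

definition strongly_convex :: "('a::real_normed_vector \<Rightarrow> real) \<Rightarrow> bool" where
  "strongly_convex h \<longleftrightarrow>
     (\<exists>m>0. \<forall>x y t. 0 \<le> t \<and> t \<le> 1 \<longrightarrow>
        h ((1 - t) *\<^sub>R x + t *\<^sub>R y)
          \<le> (1 - t) * h x + t * h y - m / 2 * t * (1 - t) * (norm (x - y))\<^sup>2)"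


section \<open>The group-regularized problem\<close>

record ('n::finite) problem =
  smooth :: "real^'n \<Rightarrow> real"
  ngroups :: nat
  group :: "nat \<Rightarrow> 'n set"
  weight :: "nat \<Rightarrow> real"

definition valid_problem :: "('n::finite) problem \<Rightarrow> bool" where
  "valid_problem P \<longleftrightarrow>
     partition_on UNIV (group P ` {1..ngroups P}) \<and> inj_on (group P) {1..ngroups P} \<and>
     (\<forall>i\<in>{1..ngroups P}. 0 < weight P i)"

definition regularizer :: "('n::finite) problem \<Rightarrow> real^'n \<Rightarrow> real" where
  "regularizer P x = (\<Sum>i=1..ngroups P. weight P i * norm (proj (group P i) x))"

definition objective :: "('n::finite) problem \<Rightarrow> real^'n \<Rightarrow> real" where
  "objective P x = smooth P x + regularizer P x"

definition level_set :: "('n::finite) problem \<Rightarrow> real^'n \<Rightarrow> (real^'n) set" where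
  "level_set P x0 = {x. objective P x \<le> objective P x0}"

definition groups_in :: "('n::finite) problem \<Rightarrow> 'n set \<Rightarrow> nat set" where
  "groups_in P I = {i \<in> {1..ngroups P}. group P i \<subseteq> I}"

definition union_of_groups :: "('n::finite) problem \<Rightarrow> 'n set \<Rightarrow> bool" where
  "union_of_groups P I \<longleftrightarrow> (\<exists>S \<subseteq> {1..ngroups P}. I = (\<Union>i\<in>S. group P i))"

definition prox_grad :: "('n::finite) problem \<Rightarrow> real^'n \<Rightarrow> real \<Rightarrow> real^'n" where
  "prox_grad P x a =
     arg_min_on (\<lambda>y. 1 / (2 * a) * (norm (y - (x - a *\<^sub>R gradient (smooth P) x)))\<^sup>2
                     + regularizer P y) UNIV"

definition pg_step :: "('n::finite) problem \<Rightarrow> real^'n \<Rightarrow> real \<Rightarrow> real^'n" where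
  "pg_step P x a = prox_grad P x a - x"


section \<open>The algorithm\<close>

record params =
  phi :: real
  xi :: real
  eta :: real
  zeta :: real
  kappa1 :: real
  kappa2 :: real
  p_exp :: real
  theta :: real
  q_exp :: real

definition valid_params :: "params \<Rightarrow> bool" where
  "valid_params A \<longleftrightarrow>
     0 < phi A \<and> phi A < 1 \<and> 0 < xi A \<and> xi A < 1 \<and>
     0 < eta A \<and> eta A < 1 \<and> 0 < zeta A \<and> zeta A < 1 \<and>
     0 < kappa1 A \<and> 0 < kappa2 A \<and> 0 < p_exp A \<and>
     0 < theta A \<and> theta A < pi / 2 \<and> 1 \<le> q_exp A \<and> q_exp A \<le> 2"

text \<open>
  A run consists of the iterates, the proximal parameters and the free choices made by the
  algorithm.  The last three components matter only in iterations of CG type.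
\<close>

record ('n::finite) run =
  iter :: "nat \<Rightarrow> real^'n"
  alpha :: "nat \<Rightarrow> real"
  wset :: "nat \<Rightarrow> 'n set"
  Hmat :: "nat \<Rightarrow> real^'n^'n"
  mu :: "nat \<Rightarrow> real"
  dir :: "nat \<Rightarrow> real^'n"

definition step :: "('n::finite) problem \<Rightarrow> 'n run \<Rightarrow> nat \<Rightarrow> real^'n" where
  "step P R k = pg_step P (iter R k) (alpha R k)"

definition I_cg_bar :: "('n::finite) problem \<Rightarrow> params \<Rightarrow> 'n run \<Rightarrow> nat \<Rightarrow> 'n set" where
  "I_cg_bar P A R k =
     \<Union>{group P i | i. i \<in> {1..ngroups P} \<and>
         proj (group P i) (iter R k) \<noteq> 0 \<and>
         proj (group P i) (iter R k + step P R k) \<noteq> 0 \<and>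
         norm (proj (group P i) (iter R k))
           \<ge> kappa1 A * norm (partial_gradient (group P i) (objective P) (iter R k))}"

definition I_small :: "('n::finite) problem \<Rightarrow> params \<Rightarrow> 'n run \<Rightarrow> nat \<Rightarrow> 'n set" where
  "I_small P A R k =
     \<Union>{group P i | i. i \<in> groups_in P (I_cg_bar P A R k) \<and>
         norm (proj (group P i) (iter R k))
           < kappa2 A *
             norm (partial_gradient (I_cg_bar P A R k) (objective P) (iter R k)) powr p_exp A}"

definition I_cg :: "('n::finite) problem \<Rightarrow> params \<Rightarrow> 'n run \<Rightarrow> nat \<Rightarrow> 'n set" where
  "I_cg P A R k = I_cg_bar P A R k - I_small P A R k"

definition I_pg :: "('n::finite) problem \<Rightarrow> params \<Rightarrow> 'n run \<Rightarrow> nat \<Rightarrow> 'n set" where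
  "I_pg P A R k = UNIV - I_cg P A R k"

definition chi_cg :: "('n::finite) problem \<Rightarrow> params \<Rightarrow> 'n run \<Rightarrow> nat \<Rightarrow> real" where
  "chi_cg P A R k = norm (proj (I_cg P A R k) (step P R k))"

definition chi_pg :: "('n::finite) problem \<Rightarrow> params \<Rightarrow> 'n run \<Rightarrow> nat \<Rightarrow> real" where
  "chi_pg P A R k = norm (proj (I_pg P A R k) (step P R k))"

definition K_cg :: "('n::finite) problem \<Rightarrow> params \<Rightarrow> 'n run \<Rightarrow> nat set" where
  "K_cg P A R = {k. chi_pg P A R k \<le> chi_cg P A R k}"

definition K_pg :: "('n::finite) problem \<Rightarrow> params \<Rightarrow> 'n run \<Rightarrow> nat set" where
  "K_pg P A R = {k. \<not> chi_pg P A R k \<le> chi_cg P A R k}"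

definition grad_k :: "('n::finite) problem \<Rightarrow> 'n run \<Rightarrow> nat \<Rightarrow> real^'n" where
  "grad_k P R k = partial_gradient (wset R k) (objective P) (iter R k)"

definition quad_model :: "real^'n::finite \<Rightarrow> real^'n^'n \<Rightarrow> real^'n \<Rightarrow> real" where
  "quad_model g H d = g \<bullet> d + 1 / 2 * (d \<bullet> (H *v d))"

definition cg_direction :: "('n::finite) problem \<Rightarrow> params \<Rightarrow> 'n run \<Rightarrow> nat \<Rightarrow> bool" where
  "cg_direction P A R k \<longleftrightarrow>
     (let g = grad_k P R k; H = Hmat R k; d = dir R k;
          b = (norm g)\<^sup>2 / (g \<bullet> (H *v g));
          dR = - b *\<^sub>R g
      in vec_on (wset R k) d \<and>
         g \<bullet> d \<le> g \<bullet> dR \<and>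
         quad_model g H d \<le> quad_model g H 0 \<and>
         norm (H *v d + g) \<le> mu R k * norm g powr q_exp A)"

definition rho :: "('n::finite) problem \<Rightarrow> params \<Rightarrow> 'n run \<Rightarrow> nat \<Rightarrow> nat \<Rightarrow> real" where
  "rho P A R k i =
     max (kappa1 A * norm (partial_gradient (group P i) (objective P) (iter R k)))
         (kappa2 A *
            norm (partial_gradient (I_cg P A R k) (objective P) (iter R k)) powr p_exp A)"

definition rho_bar :: "('n::finite) problem \<Rightarrow> params \<Rightarrow> 'n run \<Rightarrow> nat \<Rightarrow> nat \<Rightarrow> real" where
  "rho_bar P A R k i =
     min (rho P A R k i) (sin (theta A) * norm (proj (group P i) (iter R k)))"

definition tau_grp :: "('n::finite) problem \<Rightarrow> params \<Rightarrow> 'n run \<Rightarrow> nat \<Rightarrow> nat \<Rightarrow> ereal" where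
  "tau_grp P A R k i =
     (if \<exists>t\<ge>0. norm (proj (group P i) (iter R k + t *\<^sub>R dir R k)) \<le> rho_bar P A R k i
      then ereal (LEAST t. 0 < t \<and>
             norm (proj (group P i) (iter R k + t *\<^sub>R dir R k)) = rho_bar P A R k i)
      else \<infinity>)"

definition tau :: "('n::finite) problem \<Rightarrow> params \<Rightarrow> 'n run \<Rightarrow> nat \<Rightarrow> ereal" where
  "tau P A R k = (INF i\<in>groups_in P (wset R k). tau_grp P A R k i)"

text \<open>As \<open>dir R k\<close> vanishes outside \<open>wset R k\<close>, the trial point agrees with the iterate there.\<close>

definition cg_trial :: "('n::finite) problem \<Rightarrow> params \<Rightarrow> 'n run \<Rightarrow> nat \<Rightarrow> nat \<Rightarrow> real^'n" where
  "cg_trial P A R k j =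
     proj (- \<Union>{group P i | i. i \<in> groups_in P (wset R k) \<and> tau_grp P A R k i \<le> ereal (xi A ^ j)})
          (iter R k + (xi A ^ j) *\<^sub>R dir R k)"

definition cg_accept_zero ::
    "('n::finite) problem \<Rightarrow> params \<Rightarrow> 'n run \<Rightarrow> nat \<Rightarrow> nat \<Rightarrow> bool" where
  "cg_accept_zero P A R k j \<longleftrightarrow>
     tau P A R k \<le> ereal (xi A ^ j) \<and>
     objective P (cg_trial P A R k j) \<le> objective P (iter R k)"

definition cg_accept_sd ::
    "('n::finite) problem \<Rightarrow> params \<Rightarrow> 'n run \<Rightarrow> nat \<Rightarrow> nat \<Rightarrow> bool" where
  "cg_accept_sd P A R k j \<longleftrightarrow>
     ereal (xi A ^ j) < tau P A R k \<and>
     objective P (iter R k + (xi A ^ j) *\<^sub>R dir R k)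
       \<le> objective P (iter R k) + eta A * xi A ^ j * (grad_k P R k \<bullet> dir R k)"

definition cg_search :: "('n::finite) problem \<Rightarrow> params \<Rightarrow> 'n run \<Rightarrow> nat \<Rightarrow> bool" where
  "cg_search P A R k \<longleftrightarrow>
     (\<exists>j. cg_accept_zero P A R k j \<and> (\<forall>l<j. \<not> cg_accept_zero P A R k l) \<and>
          iter R (Suc k) = cg_trial P A R k j) \<or>
     (\<forall>l. \<not> cg_accept_zero P A R k l) \<and>
     (\<exists>j. cg_accept_sd P A R k j \<and> (\<forall>l<j. \<not> cg_accept_sd P A R k l) \<and>
          iter R (Suc k) = iter R k + (xi A ^ j) *\<^sub>R dir R k)"

definition cg_iteration :: "('n::finite) problem \<Rightarrow> params \<Rightarrow> 'n run \<Rightarrow> nat \<Rightarrow> bool" where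
  "cg_iteration P A R k \<longleftrightarrow>
     wset R k \<subseteq> I_cg P A R k \<and> union_of_groups P (wset R k) \<and>
     norm (proj (wset R k) (step P R k)) \<ge> phi A * chi_cg P A R k \<and>
     sym_pos_def_on (wset R k) (Hmat R k) \<and>
     0 < mu R k \<and> mu R k \<le> 1 \<and>
     cg_direction P A R k \<and>
     cg_search P A R k \<and>
     alpha R (Suc k) = alpha R k"

definition pg_accept :: "('n::finite) problem \<Rightarrow> params \<Rightarrow> 'n run \<Rightarrow> nat \<Rightarrow> nat \<Rightarrow> bool" where
  "pg_accept P A R k j \<longleftrightarrow>
     objective P (iter R k + (xi A ^ j) *\<^sub>R proj (wset R k) (step P R k))
       \<le> objective P (iter R k)
          - eta A * xi A ^ j * (1 / alpha R k) * (norm (proj (wset R k) (step P R k)))\<^sup>2"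

definition pg_iteration :: "('n::finite) problem \<Rightarrow> params \<Rightarrow> 'n run \<Rightarrow> nat \<Rightarrow> bool" where
  "pg_iteration P A R k \<longleftrightarrow>
     wset R k \<subseteq> I_pg P A R k \<and> union_of_groups P (wset R k) \<and>
     norm (proj (wset R k) (step P R k)) \<ge> phi A * chi_pg P A R k \<and>
     (\<exists>j. pg_accept P A R k j \<and> (\<forall>l<j. \<not> pg_accept P A R k l) \<and>
          iter R (Suc k) = iter R k + (xi A ^ j) *\<^sub>R proj (wset R k) (step P R k) \<and>
          alpha R (Suc k) = (if j = 0 then alpha R k else zeta A * alpha R k))"

definition algorithm_run :: "('n::finite) problem \<Rightarrow> params \<Rightarrow> 'n run \<Rightarrow> bool" where
  "algorithm_run P A R \<longleftrightarrow>
     0 < alpha R 0 \<and> alpha R 0 \<le> 1 \<and>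
     (\<forall>k. (k \<in> K_cg P A R \<longrightarrow> cg_iteration P A R k) \<and>
          (k \<in> K_pg P A R \<longrightarrow> pg_iteration P A R k))"

end

theory Submission
  imports Defs
begin

text \<open>
  Every iteration other than a zeroing CG step decreases the objective by an amount bounded below
  in terms of the optimality measure \<open>max \<chi>\<^sup>c\<^sup>g \<chi>\<^sup>p\<^sup>g\<close>.  For PG steps this is the usual descent
  estimate.  For CG steps the tests that define the CG index set keep the norms of the groups involved
  away from zero as long as the measure is, and the norm lies below the quadratic
  \<open>\<parallel>a\<parallel> + a \<bullet> v / \<parallel>a\<parallel> + \<parallel>v\<parallel>\<^sup>2 / (2 \<parallel>a\<parallel>)\<close>, so short steps along the direction are accepted.
  A zeroing CG step increases the number of zero groups, which only a PG step can decrease.  Hence the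
  measure cannot stay away from zero.  By convexity the gap of the objective to its minimum is bounded
  by a multiple of the length of the PG step, so this monotone gap tends to zero; conversely it bounds
  the squared distance to the minimizer (strong convexity) and the squared length of the PG step.
\<close>

section \<open>Coordinate projections\<close>

lemma proj_nth [simp]: "proj I x $ i = (if i \<in> I then x $ i else 0)"
  by (simp add: proj_def)

lemma proj_add: "proj I (x + y) = proj I x + proj I y"
  by (simp add: vec_eq_iff)

lemma proj_diff: "proj I (x - y) = proj I x - proj I y"
  by (simp add: vec_eq_iff)

lemma proj_scaleR: "proj I (c *\<^sub>R x) = c *\<^sub>R proj I x"
  by (simp add: vec_eq_iff)

lemma proj_zero [simp]: "proj I 0 = 0"
  by (simp add: vec_eq_iff)

lemma proj_proj: "proj I (proj J x) = proj (I \<inter> J) x"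
  by (simp add: vec_eq_iff)

lemma proj_empty [simp]: "proj {} x = 0"
  by (simp add: vec_eq_iff)

lemma proj_UNIV [simp]: "proj UNIV x = x"
  by (simp add: vec_eq_iff)

lemma inner_proj: "proj I x \<bullet> y = x \<bullet> proj I (y :: real^'n::finite)"
  unfolding inner_vec_def by (intro sum.cong) auto

lemma norm_proj_le: "norm (proj I x) \<le> norm (x :: real^'n::finite)"
  by (rule norm_le_componentwise_cart) auto

lemma norm_proj_mono: "I \<subseteq> J \<Longrightarrow> norm (proj I x) \<le> norm (proj J (x :: real^'n::finite))"
  by (rule norm_le_componentwise_cart) auto

lemma bounded_linear_proj: "bounded_linear (proj I :: real^'n::finite \<Rightarrow> real^'n)"
  by (rule bounded_linear_intro[where K=1]) (auto simp: proj_add proj_scaleR norm_proj_le)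

lemma vec_on_iff: "vec_on I v \<longleftrightarrow> proj I v = v"
  by (auto simp: vec_on_def vec_eq_iff)

lemma norm_le_proj_add_Compl: "norm x \<le> norm (proj I x) + norm (proj (UNIV - I) (x :: real^'n::finite))"
proof -
  have "x = proj I x + proj (UNIV - I) x"
    by (simp add: vec_eq_iff)
  then show ?thesis
    by (metis norm_triangle_ineq)
qed


section \<open>Norms and gradients\<close>

text \<open>Cauchy-Schwarz for \<open>a\<close> and \<open>a + v\<close>, divided by
  \<open>norm a\<close>. At \<open>a = 0\<close> the slope \<open>1 / norm a\<close> is read as
  \<open>0\<close>, the same convention as in \<open>reg_grad\<close>.\<close>

lemma norm_ge_tangent:
  fixes a v :: "'a::real_inner"
  assumes "a = 0 \<Longrightarrow> v = 0"
  shows "norm a + (1 / norm a) * (a \<bullet> v) \<le> norm (a + v)"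
proof (cases "a = 0")
  case False
  have "a \<bullet> (a + v) \<le> norm a * norm (a + v)"
    by (rule norm_cauchy_schwarz)
  then have "(norm a)\<^sup>2 + a \<bullet> v \<le> norm a * norm (a + v)"
    by (simp add: inner_add_right power2_norm_eq_inner)
  with False show ?thesis
    by (simp add: field_simps power2_eq_square)
qed (use assms in auto)

text \<open>The square of \<open>norm (a + v) - norm a\<close> is nonnegative, which bounds
  \<open>norm (a + v)\<close> by its own square; expanding that square gives the tangent and the
  quadratic term.\<close>

lemma norm_le_quadratic:
  fixes a v :: "'a::real_inner"
  assumes "a \<noteq> 0"
  shows "norm (a + v) \<le> norm a + (1 / norm a) * (a \<bullet> v) + (1 / (2 * norm a)) * (norm v)\<^sup>2"
proof -
  have "0 \<le> (norm (a + v) - norm a)\<^sup>2"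
    by simp
  then have "2 * norm a * norm (a + v) \<le> (norm (a + v))\<^sup>2 + (norm a)\<^sup>2"
    by (simp add: power2_diff mult.commute mult.left_commute)
  also have "(norm (a + v))\<^sup>2 = (norm a)\<^sup>2 + 2 * (a \<bullet> v) + (norm v)\<^sup>2"
    by (simp add: power2_norm_eq_inner inner_add_left inner_add_right inner_commute)
  finally show ?thesis
    using assms by (simp add: field_simps power2_eq_square)
qed

text \<open>Stands in for dividing by \<open>t\<close> and letting \<open>t\<close> tend to
  \<open>0\<close> in first-order optimality arguments.\<close>

lemma nonpos_if_le_linear:
  fixes a b :: real
  assumes "\<And>t. 0 < t \<Longrightarrow> t \<le> 1 \<Longrightarrow> a \<le> t * b"
  shows "a \<le> 0"
proof (rule ccontr)
  assume "\<not> a \<le> 0"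
  then have a: "0 < a" by simp
  then have b: "a \<le> b"
    using assms[of 1] by simp
  \<comment> \<open>The choice \<open>t = a / (2 * b)\<close> is admissible because
    \<open>0 < a \<le> b\<close>, and it halves the left side.\<close>
  have "a \<le> a / (2 * b) * b"
    by (rule assms) (use a b in \<open>auto simp: field_simps\<close>)
  also have "\<dots> = a / 2"
    using a b by simp
  finally show False
    using a by simp
qed

section \<open>Gradients and Lipschitz gradients\<close>

lemma GDERIV_unique:
  assumes "GDERIV h x :> D" and "GDERIV h x :> E"
  shows "D = E"
proof -
  have "(\<lambda>u. u \<bullet> D) = (\<lambda>u. u \<bullet> E)"
    using assms unfolding gderiv_def by (rule has_derivative_unique)
  then show ?thesis
    by (metis vector_eq_ldot inner_commute)
qed

lemma gradient_eqI: "GDERIV h x :> D \<Longrightarrow> gradient h x = D"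
  unfolding gradient_def by (blast intro: the_equality GDERIV_unique)

lemma GDERIV_gradient:
  fixes h :: "real^'n::finite \<Rightarrow> real"
  assumes "h differentiable (at x)"
  shows "GDERIV h x :> gradient h x"
proof -
  obtain h' where h': "(h has_derivative h') (at x)"
    using assms by (auto simp: differentiable_def)
  then have lin: "linear h'"
    by (rule has_derivative_linear)
  \<comment> \<open>The vector representing the linear form \<open>h'\<close>: its coordinates are
    the derivatives along the basis vectors.\<close>
  define D where "D = (\<Sum>b\<in>Basis. h' b *\<^sub>R b)"
  have "h' = (\<lambda>u. u \<bullet> D)"
  proof
    fix u
    have "h' u = h' (\<Sum>b\<in>Basis. (u \<bullet> b) *\<^sub>R b)"
      by (simp add: euclidean_representation)
    also have "\<dots> = (\<Sum>b\<in>Basis. (u \<bullet> b) * h' b)"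
      by (simp add: linear_sum[OF lin] linear_cmul[OF lin])
    also have "\<dots> = u \<bullet> D"
      by (simp add: D_def inner_sum_right mult.commute)
    finally show "h' u = u \<bullet> D" .
  qed
  with h' have "GDERIV h x :> D"
    by (simp add: gderiv_def)
  then show ?thesis
    using gradient_eqI by blast
qed

text \<open>The mean value theorem along the segment turns the error into a gradient difference
  between two points of \<open>S\<close>. Evaluating at one intermediate point instead of
  integrating gives the constant \<open>M\<close> rather than \<open>M / 2\<close>.\<close>

lemma quadratic_bound_of_lipschitz_gradient:
  fixes h :: "real^'n::finite \<Rightarrow> real"
  assumes diff: "\<And>x. h differentiable (at x)"
    and lip: "M-lipschitz_on S (gradient h)" and S: "convex S" "x \<in> S" "x + v \<in> S"
  shows "\<bar>h (x + v) - h x - gradient h x \<bullet> v\<bar> \<le> M * (norm v)\<^sup>2"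
proof -
  have M: "0 \<le> M"
    using lip by (rule lipschitz_on_nonneg)
  have "((\<lambda>t. h (x + t *\<^sub>R v)) has_derivative (\<lambda>s. s * (gradient h (x + t *\<^sub>R v) \<bullet> v)))
          (at t within {0..1})" for t :: real
  proof -
    have 1: "((\<lambda>t. x + t *\<^sub>R v) has_derivative (\<lambda>s. s *\<^sub>R v)) (at t within {0..1})"
      by (auto intro!: derivative_eq_intros)
    have 2: "(h has_derivative (\<lambda>u. u \<bullet> gradient h (x + t *\<^sub>R v))) (at (x + t *\<^sub>R v))"
      using GDERIV_gradient[OF diff] by (simp add: gderiv_def)
    show ?thesis
      using has_derivative_compose[OF 1 2] by (simp add: inner_commute)
  qed
  then obtain t where t: "t \<in> {0<..<1}"
      "h (x + 1 *\<^sub>R v) - h (x + 0 *\<^sub>R v) = (1 - 0) * (gradient h (x + t *\<^sub>R v) \<bullet> v)"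
    using mvt_simple[of 0 1 "\<lambda>t. h (x + t *\<^sub>R v)" "\<lambda>t s. s * (gradient h (x + t *\<^sub>R v) \<bullet> v)"]
    by auto
  have "x + t *\<^sub>R v = (1 - t) *\<^sub>R x + t *\<^sub>R (x + v)"
    by (simp add: algebra_simps)
  then have mem: "x + t *\<^sub>R v \<in> S"
    using t S convexD_alt[of S x "x + v" t] by auto
  have "\<bar>h (x + v) - h x - gradient h x \<bullet> v\<bar> = \<bar>(gradient h (x + t *\<^sub>R v) - gradient h x) \<bullet> v\<bar>"
    using t by (simp add: inner_diff_left)
  also have "\<dots> \<le> norm (gradient h (x + t *\<^sub>R v) - gradient h x) * norm v"
    by (rule Cauchy_Schwarz_ineq2)
  also have "\<dots> \<le> (M * norm (t *\<^sub>R v)) * norm v"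
    using lipschitz_onD[OF lip mem \<open>x \<in> S\<close>] by (intro mult_right_mono) (auto simp: dist_norm)
  also have "\<dots> \<le> (M * norm v) * norm v"
    using t M by (intro mult_right_mono mult_left_mono) (auto simp: mult_left_le_one_le)
  finally show ?thesis
    by (simp add: power2_eq_square algebra_simps)
qed

text \<open>The Hessian is continuous, hence bounded on the compact ball, and the ball is convex, so
  the mean value inequality applies.\<close>

lemma twice_cont_differentiable_lipschitz_on_cball:
  fixes h :: "real^'n::finite \<Rightarrow> real"
  assumes "twice_cont_differentiable h"
  obtains M where "M-lipschitz_on (cball c b) (gradient h)"
proof -
  have diff: "\<And>x. gradient h differentiable (at x)" and cont: "continuous_on UNIV (hessian h)"
    using assms by (auto simp: twice_cont_differentiable_def)
  have "compact (hessian h ` cball c b)"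
    by (intro compact_continuous_image continuous_on_subset[OF cont]) auto
  then obtain K where K: "\<And>x. x \<in> cball c b \<Longrightarrow> norm (hessian h x) \<le> K"
    unfolding compact_eq_bounded_closed bounded_iff by blast
  \<comment> \<open>The factor \<open>CARD('n)\<close> squared is the price of bounding the operator
    norm by the entries; \<open>max 0\<close> gives the nonnegative constant that
    \<open>lipschitz_on\<close> demands.\<close>
  define M where "M = max 0 (real CARD('n) * real CARD('n) * K)"
  have "norm (gradient h x - gradient h y) \<le> M * norm (x - y)"
    if "x \<in> cball c b" "y \<in> cball c b" for x y
  proof (rule differentiable_bound[OF convex_cball _ _ that])
    fix z assume z: "z \<in> cball c b"
    show "(gradient h has_derivative frechet_derivative (gradient h) (at z)) (at z within cball c b)"
      using diff frechet_derivative_works has_derivative_at_withinI by blast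
    then have "frechet_derivative (gradient h) (at z) = (*v) (hessian h z)"
      unfolding hessian_def by (metis has_derivative_linear matrix_vector_mul(2))
    moreover have "onorm ((*v) (hessian h z)) \<le> real CARD('n) * real CARD('n) * K"
    proof (rule onorm_le_matrix_component)
      fix i j
      have "\<bar>hessian h z $ i $ j\<bar> \<le> norm (hessian h z $ i)"
        by (rule component_le_norm_cart)
      also have "\<dots> \<le> norm (hessian h z)"
        by (rule Finite_Cartesian_Product.norm_nth_le)
      finally show "\<bar>hessian h z $ i $ j\<bar> \<le> K"
        using K[OF z] by simp
    qed
    ultimately show "onorm (frechet_derivative (gradient h) (at z)) \<le> M"
      by (simp add: M_def)
  qed
  then have "M-lipschitz_on (cball c b) (gradient h)"
    by (auto simp: lipschitz_on_def M_def dist_norm)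
  then show ?thesis
    by (rule that)
qed

section \<open>The group regularizer\<close>

text \<open>Groups with \<open>proj (group P i) x = 0\<close> contribute nothing, as their coefficient is \<open>weight P i / 0 = 0\<close>.\<close>

definition reg_grad :: "('n::finite) problem \<Rightarrow> real^'n \<Rightarrow> real^'n" where
  "reg_grad P x =
     (\<Sum>i=1..ngroups P. (weight P i / norm (proj (group P i) x)) *\<^sub>R proj (group P i) x)"

definition weight_sum :: "('n::finite) problem \<Rightarrow> real" where
  "weight_sum P = (\<Sum>i=1..ngroups P. weight P i)"

text \<open>The condition under which the regularizer of a valid problem is differentiable at
  \<open>x\<close> in the variables of \<open>I\<close>, with partial gradient
  \<open>proj I (reg_grad P x)\<close>.\<close>

definition live_on :: "('n::finite) problem \<Rightarrow> 'n set \<Rightarrow> real^'n \<Rightarrow> bool" where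
  "live_on P I x \<longleftrightarrow> union_of_groups P I \<and> (\<forall>i\<in>groups_in P I. proj (group P i) x \<noteq> 0)"

locale group_problem =
  fixes P :: "('n::finite) problem"
  assumes valid: "valid_problem P"
begin

section \<open>Groups as a partition of the coordinates\<close>

lemma weight_pos: "i \<in> {1..ngroups P} \<Longrightarrow> 0 < weight P i"
  using valid by (simp add: valid_problem_def)

lemma group_nonempty: "i \<in> {1..ngroups P} \<Longrightarrow> group P i \<noteq> {}"
  using valid by (auto simp: valid_problem_def partition_on_def)

lemma group_disjoint:
  assumes "i \<in> {1..ngroups P}" "j \<in> {1..ngroups P}" "i \<noteq> j"
  shows "group P i \<inter> group P j = {}"
proof -
  have "disjoint (group P ` {1..ngroups P})" "inj_on (group P) {1..ngroups P}"
    using valid by (auto simp: valid_problem_def partition_on_def)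
  moreover from this(2) have "group P i \<noteq> group P j"
    using assms by (simp add: inj_on_eq_iff)
  ultimately show ?thesis
    using assms by (intro disjointD[of "group P ` {1..ngroups P}"]) auto
qed

text \<open>Groups are nonempty and pairwise disjoint, so a union of groups determines the indices
  that form it.\<close>

lemma group_subset_Union_iff:
  assumes "i \<in> {1..ngroups P}" "S \<subseteq> {1..ngroups P}"
  shows "group P i \<subseteq> (\<Union>j\<in>S. group P j) \<longleftrightarrow> i \<in> S"
proof
  assume *: "group P i \<subseteq> (\<Union>j\<in>S. group P j)"
  obtain e where e: "e \<in> group P i"
    using group_nonempty[OF assms(1)] by blast
  with * obtain j where j: "j \<in> S" "e \<in> group P j"
    by blast
  with e assms group_disjoint[of i j] show "i \<in> S"
    by blast
qed blast

lemma group_dichotomy: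
  assumes "union_of_groups P I" "i \<in> {1..ngroups P}"
  shows "group P i \<subseteq> I \<or> group P i \<inter> I = {}"
proof -
  obtain S where S: "S \<subseteq> {1..ngroups P}" "I = (\<Union>j\<in>S. group P j)"
    using assms by (auto simp: union_of_groups_def)
  show ?thesis
  proof (cases "i \<in> S")
    case False
    then have "group P i \<inter> group P j = {}" if "j \<in> S" for j
      using that S assms group_disjoint[of i j] by blast
    then show ?thesis
      using S by blast
  qed (use S in blast)
qed

lemma union_of_groups_UNIV: "union_of_groups P UNIV"
  using valid unfolding union_of_groups_def valid_problem_def partition_on_def by auto

lemma proj_group_proj:
  assumes "union_of_groups P I" "i \<in> {1..ngroups P}"
  shows "proj (group P i) (proj I x) = (if group P i \<subseteq> I then proj (group P i) x else 0)"
  using group_dichotomy[OF assms] group_nonempty[OF assms(2)]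
  by (auto simp: proj_proj Int_absorb2)

section \<open>Lipschitz continuity and convexity of the regularizer\<close>

lemma weight_sum_nonneg: "0 \<le> weight_sum P"
  unfolding weight_sum_def by (intro sum_nonneg) (use weight_pos in \<open>auto simp: less_imp_le\<close>)

lemma regularizer_nonneg: "0 \<le> regularizer P x"
  unfolding regularizer_def
  by (intro sum_nonneg mult_nonneg_nonneg) (use weight_pos in \<open>auto simp: less_imp_le\<close>)

lemma regularizer_diff_le: "regularizer P x - regularizer P y \<le> weight_sum P * norm (x - y)"
proof -
  have "regularizer P x - regularizer P y =
    (\<Sum>i=1..ngroups P. weight P i * (norm (proj (group P i) x) - norm (proj (group P i) y)))"
    by (simp add: regularizer_def sum_subtractf right_diff_distrib)
  also have "\<dots> \<le> (\<Sum>i=1..ngroups P. weight P i * norm (x - y))"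
  proof (intro sum_mono mult_left_mono)
    fix i
    have "norm (proj (group P i) x) - norm (proj (group P i) y) \<le> norm (proj (group P i) (x - y))"
      unfolding proj_diff by (rule norm_triangle_ineq2)
    also have "\<dots> \<le> norm (x - y)"
      by (rule norm_proj_le)
    finally show "norm (proj (group P i) x) - norm (proj (group P i) y) \<le> norm (x - y)" .
  qed (use weight_pos in \<open>auto simp: less_imp_le\<close>)
  also have "\<dots> = weight_sum P * norm (x - y)"
    by (simp add: weight_sum_def sum_distrib_right)
  finally show ?thesis .
qed

lemma continuous_on_regularizer: "continuous_on S (regularizer P)"
  unfolding regularizer_def[abs_def]
  by (intro continuous_intros bounded_linear.continuous_on[OF bounded_linear_proj])

lemma regularizer_convex:
  assumes "0 \<le> t" "t \<le> 1"
  shows "regularizer P (x + t *\<^sub>R v) \<le> regularizer P x + t * (regularizer P (x + v) - regularizer P x)"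
proof -
  have "regularizer P (x + t *\<^sub>R v) \<le> (\<Sum>i=1..ngroups P.
      weight P i * ((1 - t) * norm (proj (group P i) x) + t * norm (proj (group P i) (x + v))))"
    unfolding regularizer_def
  proof (intro sum_mono mult_left_mono)
    fix i
    have "x + t *\<^sub>R v = (1 - t) *\<^sub>R x + t *\<^sub>R (x + v)"
      by (simp add: algebra_simps)
    then have "norm (proj (group P i) (x + t *\<^sub>R v)) =
        norm ((1 - t) *\<^sub>R proj (group P i) x + t *\<^sub>R proj (group P i) (x + v))"
      by (simp only: proj_add proj_scaleR)
    also have "\<dots> \<le> norm ((1 - t) *\<^sub>R proj (group P i) x) + norm (t *\<^sub>R proj (group P i) (x + v))"
      by (rule norm_triangle_ineq)
    finally show "norm (proj (group P i) (x + t *\<^sub>R v)) \<le>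
        (1 - t) * norm (proj (group P i) x) + t * norm (proj (group P i) (x + v))"
      using assms by simp
  qed (use weight_pos in \<open>auto simp: less_imp_le\<close>)
  also have "\<dots> = (1 - t) * regularizer P x + t * regularizer P (x + v)"
    by (simp add: regularizer_def sum.distrib sum_distrib_left distrib_left mult.left_commute)
  finally show ?thesis
    by (simp add: algebra_simps)
qed

text \<open>Each group lies inside \<open>I\<close> or misses it. In either case the two summands on
  the left are those on the right, possibly exchanged. This transfers estimates for a full step to a
  block of it.\<close>

lemma regularizer_swap:
  assumes "union_of_groups P I"
  shows "regularizer P (x + proj I v) + regularizer P (x + v - proj I v)
           = regularizer P x + regularizer P (x + v)"
  unfolding regularizer_def sum.distrib[symmetric]
  by (intro sum.cong refl)
     (auto simp: proj_add proj_diff proj_group_proj[OF assms] distrib_left)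

section \<open>Tangent and quadratic bounds for the regularizer\<close>

lemma inner_reg_grad:
  "reg_grad P x \<bullet> v =
     (\<Sum>i=1..ngroups P. weight P i *
        (1 / norm (proj (group P i) x) * (proj (group P i) x \<bullet> proj (group P i) v)))"
proof -
  have "proj J x \<bullet> proj J v = proj J x \<bullet> v" for J
    by (simp add: inner_proj[symmetric] proj_proj)
  then show ?thesis
    by (simp add: reg_grad_def inner_sum_left)
qed

lemma norm_reg_grad_le: "norm (reg_grad P x) \<le> weight_sum P"
  unfolding reg_grad_def weight_sum_def
proof (rule sum_norm_le)
  fix i assume "i \<in> {1..ngroups P}"
  with weight_pos[OF this] show
    "norm ((weight P i / norm (proj (group P i) x)) *\<^sub>R proj (group P i) x) \<le> weight P i"
    by simp
qed

text \<open>\<open>norm_ge_tangent\<close> summed over the groups; a group that vanishes at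
  \<open>x\<close> lies outside \<open>I\<close>, so \<open>v\<close> vanishes on it as
  well.\<close>

lemma regularizer_ge_tangent:
  assumes "live_on P I x" "vec_on I v"
  shows "regularizer P x + reg_grad P x \<bullet> v \<le> regularizer P (x + v)"
  unfolding regularizer_def inner_reg_grad sum.distrib[symmetric] distrib_left[symmetric] proj_add
proof (intro sum_mono mult_left_mono norm_ge_tangent)
  fix i assume i: "i \<in> {1..ngroups P}" and "proj (group P i) x = 0"
  then have "\<not> group P i \<subseteq> I"
    using assms by (auto simp: live_on_def groups_in_def)
  then show "proj (group P i) v = 0"
    using assms i proj_group_proj[of I i v] by (simp add: live_on_def vec_on_iff)
qed (use weight_pos in \<open>auto simp: less_imp_le\<close>)


text \<open>\<open>norm_le_quadratic\<close> on the groups inside \<open>I\<close>, where the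
  curvature is at most \<open>1 / w\<close>; the other groups are not moved by
  \<open>v\<close>.\<close>

lemma regularizer_le_quadratic:
  assumes live: "live_on P I x" and v: "vec_on I v" and w: "0 < w"
    and lower: "\<And>i. i \<in> groups_in P I \<Longrightarrow> w \<le> norm (proj (group P i) x)"
  shows "regularizer P (x + v)
           \<le> regularizer P x + reg_grad P x \<bullet> v + weight_sum P / (2 * w) * (norm v)\<^sup>2"
proof -
  have *: "norm (proj (group P i) x + proj (group P i) v)
      \<le> norm (proj (group P i) x)
        + 1 / norm (proj (group P i) x) * (proj (group P i) x \<bullet> proj (group P i) v)
        + 1 / (2 * w) * (norm v)\<^sup>2" if i: "i \<in> {1..ngroups P}" for i
  proof (cases "group P i \<subseteq> I")
    case True
    then have wi: "w \<le> norm (proj (group P i) x)"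
      using i lower by (simp add: groups_in_def)
    have "1 / (2 * norm (proj (group P i) x)) * (norm (proj (group P i) v))\<^sup>2
        \<le> 1 / (2 * w) * (norm v)\<^sup>2"
      using w wi norm_proj_le[of "group P i" v] by (intro mult_mono power_mono frac_le) auto
    moreover have "proj (group P i) x \<noteq> 0"
      using w wi by auto
    ultimately show ?thesis
      using norm_le_quadratic[of "proj (group P i) x" "proj (group P i) v"] by linarith
  next
    case False
    then have "proj (group P i) v = 0"
      using live v i proj_group_proj[of I i v] by (simp add: live_on_def vec_on_iff)
    then show ?thesis
      using w by simp
  qed
  have "regularizer P (x + v) \<le> (\<Sum>i=1..ngroups P. weight P i * (norm (proj (group P i) x)
        + 1 / norm (proj (group P i) x) * (proj (group P i) x \<bullet> proj (group P i) v)
        + 1 / (2 * w) * (norm v)\<^sup>2))"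
    unfolding regularizer_def proj_add
    by (intro sum_mono mult_left_mono *) (use weight_pos in \<open>auto simp: less_imp_le\<close>)
  also have "\<dots> = regularizer P x + reg_grad P x \<bullet> v + weight_sum P * (1 / (2 * w) * (norm v)\<^sup>2)"
    unfolding regularizer_def inner_reg_grad weight_sum_def
    by (simp only: distrib_left sum.distrib sum_distrib_right)
  finally show ?thesis
    by simp
qed


text \<open>As a function of \<open>u\<close>, the norm of a group inside \<open>I\<close> is
  differentiable at \<open>0\<close> because the group is nonzero at \<open>x\<close>, and the norm
  of any other group is constant.\<close>

lemma partial_gradient_objective:
  assumes live: "live_on P I x" and diff: "smooth P differentiable (at x)"
  shows "partial_gradient I (objective P) x = proj I (gradient (smooth P) x + reg_grad P x)"
  unfolding partial_gradient_def
proof (rule gradient_eqI)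
  have lin: "((\<lambda>u. x + proj I u) has_derivative proj I) (at 0)"
    using has_derivative_add[OF has_derivative_const
        bounded_linear.has_derivative[OF bounded_linear_proj has_derivative_ident]] by simp
  have f: "((\<lambda>u. smooth P (x + proj I u)) has_derivative
      (\<lambda>h. proj I h \<bullet> gradient (smooth P) x)) (at 0)"
    using has_derivative_compose[OF lin, of "smooth P" "\<lambda>u. u \<bullet> gradient (smooth P) x"]
      GDERIV_gradient[OF diff] by (simp add: gderiv_def)
  have r: "((\<lambda>u. weight P i * norm (proj (group P i) (x + proj I u))) has_derivative
      (\<lambda>h. weight P i * (1 / norm (proj (group P i) x) *
         (proj (group P i) x \<bullet> proj (group P i) (proj I h))))) (at 0)"
    if i: "i \<in> {1..ngroups P}" for i
  proof (cases "group P i \<subseteq> I")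
    case True
    then have nz: "proj (group P i) x \<noteq> 0"
      using i live by (auto simp: live_on_def groups_in_def)
    have lin': "((\<lambda>u. proj (group P i) (x + proj I u)) has_derivative
        (\<lambda>h. proj (group P i) (proj I h))) (at 0)"
      by (rule bounded_linear.has_derivative[OF bounded_linear_proj lin])
    have "((\<lambda>u. norm (proj (group P i) (x + proj I u))) has_derivative
        (\<lambda>h. proj (group P i) (proj I h) \<bullet> sgn (proj (group P i) x))) (at 0)"
      using has_derivative_compose[OF lin', of norm "\<lambda>h. h \<bullet> sgn (proj (group P i) x)"]
        has_derivative_norm[OF nz] by simp
    then have "((\<lambda>u. weight P i * norm (proj (group P i) (x + proj I u))) has_derivative
        (\<lambda>h. weight P i * (proj (group P i) (proj I h) \<bullet> sgn (proj (group P i) x)))) (at 0)"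
      by (rule has_derivative_mult_right)
    moreover have "h \<bullet> sgn y = 1 / norm y * (y \<bullet> h)" for h y :: "real^'n"
      by (simp add: sgn_div_norm inner_commute[of y h] divide_inverse)
    ultimately show ?thesis
      by simp
  next
    case False
    then have "proj (group P i) (proj I u) = 0" for u
      using live i by (simp add: proj_group_proj live_on_def)
    then show ?thesis
      by (simp add: proj_add)
  qed
  have "proj I h \<bullet> gradient (smooth P) x + reg_grad P x \<bullet> proj I h
      = h \<bullet> proj I (gradient (smooth P) x + reg_grad P x)" for h
    unfolding inner_commute[of "reg_grad P x"] inner_add_right[symmetric] by (rule inner_proj)
  then have eq: "(\<lambda>h. proj I h \<bullet> gradient (smooth P) x + reg_grad P x \<bullet> proj I h)
      = (\<lambda>h. h \<bullet> proj I (gradient (smooth P) x + reg_grad P x))"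
    by (rule ext)
  have "((\<lambda>u. objective P (x + proj I u)) has_derivative
      (\<lambda>h. proj I h \<bullet> gradient (smooth P) x + reg_grad P x \<bullet> proj I h)) (at 0)"
    unfolding objective_def regularizer_def inner_reg_grad
    by (rule has_derivative_add[OF f has_derivative_sum[OF r]])
  then show "GDERIV (\<lambda>u. objective P (x + proj I u)) 0 :> proj I (gradient (smooth P) x + reg_grad P x)"
    unfolding gderiv_def eq .
qed


section \<open>The proximal gradient step\<close>

text \<open>\<open>arg_min_on\<close> denotes a minimizer only if one exists. A compact ball
  provides one, since outside it the quadratic term alone reaches the value at the center.\<close>

lemma is_arg_min_prox_grad:
  assumes "0 < a"
  shows "1 / (2 * a) * (norm (prox_grad P x a - (x - a *\<^sub>R gradient (smooth P) x)))\<^sup>2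
           + regularizer P (prox_grad P x a)
         \<le> 1 / (2 * a) * (norm (y - (x - a *\<^sub>R gradient (smooth P) x)))\<^sup>2 + regularizer P y"
proof -
  define z where "z = x - a *\<^sub>R gradient (smooth P) x"
  define h where "h y = 1 / (2 * a) * (norm (y - z))\<^sup>2 + regularizer P y" for y
  \<comment> \<open>Chosen so that \<open>1 / (2 * a) * b\<^sup>2\<close> is the value
    \<open>h z\<close>.\<close>
  define b where "b = sqrt (2 * a * regularizer P z)"
  have b: "0 \<le> b"
    unfolding b_def using assms regularizer_nonneg[of z] by simp
  have "continuous_on (cball z b) h"
    unfolding h_def[abs_def] by (intro continuous_intros continuous_on_regularizer)
  then obtain y0 where y0: "y0 \<in> cball z b" "\<And>y. y \<in> cball z b \<Longrightarrow> h y0 \<le> h y"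
    using continuous_attains_inf[of "cball z b" h] b by auto
  have "h y0 \<le> h y" for y
  proof (cases "y \<in> cball z b")
    case False
    then have "b \<le> norm (y - z)"
      by (simp add: dist_norm norm_minus_commute)
    then have "b\<^sup>2 \<le> (norm (y - z))\<^sup>2"
      using b by (intro power_mono) auto
    then have "regularizer P z \<le> 1 / (2 * a) * (norm (y - z))\<^sup>2"
      using assms regularizer_nonneg by (simp add: b_def field_simps)
    moreover have "h y0 \<le> h z"
      using y0 b by simp
    moreover have "h z = regularizer P z"
      by (simp add: h_def)
    ultimately show ?thesis
      using regularizer_nonneg[of y] by (simp add: h_def)
  qed (use y0 in blast)
  then have "is_arg_min h (\<lambda>x. x \<in> UNIV) y0"
    by (simp add: is_arg_min_def not_less)
  then have "is_arg_min h (\<lambda>x. x \<in> UNIV) (arg_min_on h UNIV)"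
    unfolding arg_min_on_def arg_min_def by (rule someI)
  moreover have "arg_min_on h UNIV = prox_grad P x a"
    by (simp add: prox_grad_def h_def[abs_def] z_def)
  ultimately show ?thesis
    by (auto simp: is_arg_min_def not_less h_def z_def)
qed

text \<open>Optimality of the proximal point: minus
  \<open>gradient (smooth P) x + (1 / a) *\<^sub>R s\<close> is a subgradient of the regularizer at
  \<open>x + s\<close>. The minimizer is compared with points at fraction \<open>t\<close> of the
  way to \<open>w\<close>, and \<open>t\<close> is sent to \<open>0\<close>.\<close>

lemma pg_step_subgradient:
  assumes a: "0 < a" and s: "s = pg_step P x a"
  shows "regularizer P (x + s) - (gradient (smooth P) x + (1 / a) *\<^sub>R s) \<bullet> (w - (x + s))
           \<le> regularizer P w"
proof -
  define z where "z = x - a *\<^sub>R gradient (smooth P) x"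
  define y where "y = x + s"
  have y: "y = prox_grad P x a"
    by (simp add: y_def s pg_step_def)
  have yz: "y - z = a *\<^sub>R (gradient (smooth P) x + (1 / a) *\<^sub>R s)"
    using a by (simp add: y_def z_def algebra_simps)
  define D where "D = regularizer P y - (gradient (smooth P) x + (1 / a) *\<^sub>R s) \<bullet> (w - y)
      - regularizer P w"
  have "D \<le> 0"
  proof (rule nonpos_if_le_linear)
    fix t :: real assume t: "0 < t" "t \<le> 1"
    have "1 / (2 * a) * (norm (y - z))\<^sup>2 + regularizer P y
        \<le> 1 / (2 * a) * (norm (y + t *\<^sub>R (w - y) - z))\<^sup>2 + regularizer P (y + t *\<^sub>R (w - y))"
      using is_arg_min_prox_grad[OF a] unfolding y z_def by blast
    also have "(norm (y + t *\<^sub>R (w - y) - z))\<^sup>2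
        = (norm (y - z))\<^sup>2 + 2 * t * ((y - z) \<bullet> (w - y)) + t\<^sup>2 * (norm (w - y))\<^sup>2"
    proof -
      have "y + t *\<^sub>R (w - y) - z = (y - z) + t *\<^sub>R (w - y)"
        by simp
      then show ?thesis
        by (simp only: power2_norm_eq_inner inner_add_left inner_add_right inner_scaleR_left
            inner_scaleR_right inner_commute[of "w - y" "y - z"]) (simp add: power2_eq_square distrib_left)
    qed
    also have "regularizer P (y + t *\<^sub>R (w - y)) \<le> regularizer P y + t * (regularizer P w - regularizer P y)"
      using regularizer_convex[of t y "w - y"] t by simp
    finally have "0 \<le> 1 / (2 * a) * (2 * t * ((y - z) \<bullet> (w - y))) + 1 / (2 * a) * (t\<^sup>2 * (norm (w - y))\<^sup>2)
        + t * (regularizer P w - regularizer P y)"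
      unfolding distrib_left by linarith
    also have "1 / (2 * a) * (2 * t * ((y - z) \<bullet> (w - y)))
        = t * ((gradient (smooth P) x + (1 / a) *\<^sub>R s) \<bullet> (w - y))"
      using a unfolding yz inner_scaleR_left by simp
    finally have "0 \<le> t * (t * (1 / (2 * a) * (norm (w - y))\<^sup>2) - D)"
      by (simp add: D_def power2_eq_square algebra_simps)
    then show "D \<le> t * (1 / (2 * a) * (norm (w - y))\<^sup>2)"
      using t by (simp add: zero_le_mult_iff)
  qed
  then show ?thesis
    by (simp add: D_def y_def)
qed

text \<open>The subgradient inequality is tested at \<open>x + s - proj I s\<close>, where the block
  \<open>I\<close> of the step is undone; \<open>regularizer_swap\<close> then exchanges the roles
  of the block and its complement.\<close>

lemma pg_step_decrease:
  assumes a: "0 < a" and s: "s = pg_step P x a" and I: "union_of_groups P I"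
  shows "gradient (smooth P) x \<bullet> proj I s + (regularizer P (x + proj I s) - regularizer P x)
           \<le> - (1 / a) * (norm (proj I s))\<^sup>2"
proof -
  have "regularizer P (x + s) - (gradient (smooth P) x + (1 / a) *\<^sub>R s) \<bullet> (- proj I s)
      \<le> regularizer P (x + s - proj I s)"
    using pg_step_subgradient[OF a s, of "x + s - proj I s"] by simp
  moreover have "s \<bullet> proj I s = (norm (proj I s))\<^sup>2"
    by (simp add: power2_norm_eq_inner inner_proj proj_proj)
  ultimately show ?thesis
    using regularizer_swap[OF I, of x s]
    by (simp add: inner_add_left)
qed

text \<open>The decrease of the full step is quadratic in \<open>norm s\<close>, while Lipschitz
  continuity and Cauchy-Schwarz bound it linearly; \<open>a \<le> 1\<close> removes the factor
  \<open>1 / a\<close>.\<close>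

lemma norm_pg_step_le:
  assumes a: "0 < a" "a \<le> 1" and s: "s = pg_step P x a"
  shows "norm s \<le> norm (gradient (smooth P) x) + weight_sum P"
proof (cases "s = 0")
  case False
  have "(norm s)\<^sup>2 \<le> (1 / a) * (norm s)\<^sup>2"
    using a by (simp add: field_simps mult_left_le_one_le)
  also have "\<dots> \<le> regularizer P x - regularizer P (x + s) - gradient (smooth P) x \<bullet> s"
    using pg_step_decrease[OF a(1) s union_of_groups_UNIV] by simp
  also have "\<dots> \<le> weight_sum P * norm s + norm (gradient (smooth P) x) * norm s"
    using regularizer_diff_le[of x "x + s"] norm_cauchy_schwarz[of "- gradient (smooth P) x" s]
    by simp
  finally have "norm s * norm s \<le> (norm (gradient (smooth P) x) + weight_sum P) * norm s"
    by (simp add: power2_eq_square distrib_right)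
  with False show ?thesis
    by simp
qed (use weight_sum_nonneg in auto)

text \<open>Where the objective is differentiable, the decrease along the block is at most what the
  tangent allows. This lets the CG gradient dominate the measure \<chi> on the working set.\<close>

lemma norm_proj_pg_step_le:
  assumes a: "0 < a" "a \<le> 1" and s: "s = pg_step P x a" and live: "live_on P I x"
  shows "norm (proj I s) \<le> norm (proj I (gradient (smooth P) x + reg_grad P x))"
proof (cases "proj I s = 0")
  case False
  let ?G = "gradient (smooth P) x + reg_grad P x"
  have "union_of_groups P I"
    using live by (simp add: live_on_def)
  moreover have "vec_on I (proj I s)"
    by (simp add: vec_on_def)
  ultimately have "(1 / a) * (norm (proj I s))\<^sup>2 \<le> - (?G \<bullet> proj I s)"
    using pg_step_decrease[OF a(1) s] regularizer_ge_tangent[OF live]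
    by (fastforce simp: inner_add_left)
  also have "\<dots> = - (proj I ?G \<bullet> proj I s)"
    by (simp add: inner_proj proj_proj)
  also have "\<dots> \<le> norm (proj I ?G) * norm (proj I s)"
    using norm_cauchy_schwarz[of "- proj I ?G" "proj I s"] by simp
  finally have "(1 / a) * (norm (proj I s))\<^sup>2 \<le> norm (proj I ?G) * norm (proj I s)" .
  moreover have "(norm (proj I s))\<^sup>2 \<le> (1 / a) * (norm (proj I s))\<^sup>2"
    using a by (simp add: field_simps mult_left_le_one_le)
  ultimately have "norm (proj I s) * norm (proj I s) \<le> norm (proj I ?G) * norm (proj I s)"
    by (simp add: power2_eq_square)
  then show ?thesis
    using False by simp
qed simp

end

section \<open>Descent along a run\<close>

definition zero_groups :: "('n::finite) problem \<Rightarrow> real^'n \<Rightarrow> nat set" where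
  "zero_groups P x = {i \<in> {1..ngroups P}. proj (group P i) x = 0}"

text \<open>
  \<open>D\<close> bounds the lengths of the PG steps and of the CG directions; \<open>M\<close> need only control the
  smooth part on displacements of that size.
\<close>

locale bounded_run = group_problem P for P :: "('n::finite) problem" +
  fixes A :: params and R :: "'n run" and L_f mu_min mu_max M D :: real
  assumes params: "valid_params A" and run: "algorithm_run P A R"
    and diff: "smooth P differentiable (at x)"
    and grad_bound: "x \<in> level_set P (iter R 0) \<Longrightarrow> norm (gradient (smooth P) x) \<le> L_f"
    and mu_min: "0 < mu_min"
    and H_lower: "k \<in> K_cg P A R \<Longrightarrow> vec_on (wset R k) v \<Longrightarrow>
          mu_min * (norm v)\<^sup>2 \<le> v \<bullet> (Hmat R k *v v)"
    and H_upper: "k \<in> K_cg P A R \<Longrightarrow> vec_on (wset R k) v \<Longrightarrow>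
          v \<bullet> (Hmat R k *v v) \<le> mu_max * (norm v)\<^sup>2"
    and mu_le: "mu_min \<le> mu_max"
    and D: "0 < D" "L_f + weight_sum P \<le> D" "2 * (L_f + weight_sum P) / mu_min \<le> D"
    and M: "0 < M"
    and smooth_quadratic: "x \<in> level_set P (iter R 0) \<Longrightarrow> norm v \<le> D \<Longrightarrow>
          \<bar>smooth P (x + v) - smooth P x - gradient (smooth P) x \<bullet> v\<bar> \<le> M * (norm v)\<^sup>2"
begin

lemma param_bounds:
  "0 < phi A" "phi A < 1" "0 < xi A" "xi A < 1" "0 < eta A" "eta A < 1" "0 < zeta A" "zeta A < 1"
  "0 < kappa2 A" "0 < p_exp A" "sin (theta A) < 1"
proof -
  have "0 < theta A" "theta A < pi / 2"
    using params by (auto simp: valid_params_def)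
  then have "sin (theta A) < sin (pi / 2)"
    by (intro sin_monotone_2pi) auto
  then show "sin (theta A) < 1" by simp
qed (use params in \<open>auto simp: valid_params_def\<close>)

lemma K_cases: "k \<in> K_cg P A R \<or> k \<in> K_pg P A R"
  by (auto simp: K_cg_def K_pg_def)

lemma cg_iterationD: "k \<in> K_cg P A R \<Longrightarrow> cg_iteration P A R k"
  and pg_iterationD: "k \<in> K_pg P A R \<Longrightarrow> pg_iteration P A R k"
  using run by (auto simp: algorithm_run_def)

text \<open>The tests defining \<open>I_cg_bar\<close> admit only nonzero groups, and a union of
  groups contains no groups besides those forming it. Hence the objective is differentiable in the
  variables used by CG iterations.\<close>

lemma live_on_wset:
  assumes k: "k \<in> K_cg P A R"
  shows "live_on P (wset R k) (iter R k)" "live_on P (I_cg_bar P A R k) (iter R k)"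
    "wset R k \<subseteq> I_cg_bar P A R k"
proof -
  define S where "S = {i \<in> {1..ngroups P}.
         proj (group P i) (iter R k) \<noteq> 0 \<and>
         proj (group P i) (iter R k + step P R k) \<noteq> 0 \<and>
         norm (proj (group P i) (iter R k))
           \<ge> kappa1 A * norm (partial_gradient (group P i) (objective P) (iter R k))}"
  have I: "I_cg_bar P A R k = (\<Union>i\<in>S. group P i)"
    unfolding I_cg_bar_def S_def by blast
  have S: "S \<subseteq> {1..ngroups P}" "\<And>i. i \<in> S \<Longrightarrow> proj (group P i) (iter R k) \<noteq> 0"
    by (auto simp: S_def)
  then show live: "live_on P (I_cg_bar P A R k) (iter R k)"
    using group_subset_Union_iff[OF _ S(1)]
    by (auto simp: live_on_def I groups_in_def union_of_groups_def)
  show sub: "wset R k \<subseteq> I_cg_bar P A R k"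
    using cg_iterationD[OF k] by (auto simp: cg_iteration_def I_cg_def)
  show "live_on P (wset R k) (iter R k)"
    using cg_iterationD[OF k] sub live by (auto simp: cg_iteration_def live_on_def groups_in_def)
qed

section \<open>Estimates for the CG direction\<close>

lemma grad_k_eq:
  assumes k: "k \<in> K_cg P A R"
  shows "grad_k P R k = proj (wset R k) (gradient (smooth P) (iter R k) + reg_grad P (iter R k))"
  unfolding grad_k_def by (rule partial_gradient_objective[OF live_on_wset(1)[OF k] diff])

lemma vec_on_grad_k: "k \<in> K_cg P A R \<Longrightarrow> vec_on (wset R k) (grad_k P R k)"
  by (simp add: grad_k_eq vec_on_def)

lemma vec_on_dir: "k \<in> K_cg P A R \<Longrightarrow> vec_on (wset R k) (dir R k)"
  using cg_iterationD[of k] by (simp add: cg_iteration_def cg_direction_def Let_def)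

text \<open>The direction does at least as well as the reference step along the negative gradient,
  whose length factor is at least \<open>1 / mu_max\<close>.\<close>

lemma grad_k_inner_dir_le:
  assumes k: "k \<in> K_cg P A R"
  shows "grad_k P R k \<bullet> dir R k \<le> - (norm (grad_k P R k))\<^sup>2 / mu_max"
proof (cases "grad_k P R k = 0")
  case False
  let ?g = "grad_k P R k"
  have g2: "0 < (norm ?g)\<^sup>2"
    using False by simp
  have H: "mu_min * (norm ?g)\<^sup>2 \<le> ?g \<bullet> (Hmat R k *v ?g)" "?g \<bullet> (Hmat R k *v ?g) \<le> mu_max * (norm ?g)\<^sup>2"
    using H_lower H_upper k vec_on_grad_k by auto
  have pos: "0 < ?g \<bullet> (Hmat R k *v ?g)"
    using H(1) mult_pos_pos[OF mu_min g2] by linarith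
  have "?g \<bullet> dir R k \<le> - ((norm ?g)\<^sup>2 / (?g \<bullet> (Hmat R k *v ?g))) * (norm ?g)\<^sup>2"
    using cg_iterationD[OF k]
    by (simp add: cg_iteration_def cg_direction_def Let_def power2_norm_eq_inner)
  also have "\<dots> \<le> - ((norm ?g)\<^sup>2 / (mu_max * (norm ?g)\<^sup>2)) * (norm ?g)\<^sup>2"
    using H pos g2 by (intro mult_right_mono le_imp_neg_le frac_le) auto
  also have "\<dots> = - (norm ?g)\<^sup>2 / mu_max"
    using g2 by simp
  finally show ?thesis .
qed simp

text \<open>The quadratic model does not increase along the direction, and its curvature is at least
  \<open>mu_min\<close>.\<close>

lemma norm_dir_sq_le:
  assumes k: "k \<in> K_cg P A R"
  shows "mu_min / 2 * (norm (dir R k))\<^sup>2 \<le> - (grad_k P R k \<bullet> dir R k)"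
proof -
  have "grad_k P R k \<bullet> dir R k + 1 / 2 * (dir R k \<bullet> (Hmat R k *v dir R k)) \<le> 0"
    using cg_iterationD[OF k]
    by (simp add: cg_iteration_def cg_direction_def Let_def quad_model_def)
  then show ?thesis
    using H_lower[OF k vec_on_dir[OF k]] by simp
qed

lemma phi_chi_cg_le_norm_grad_k:
  assumes k: "k \<in> K_cg P A R" and a: "0 < alpha R k" "alpha R k \<le> 1"
  shows "phi A * chi_cg P A R k \<le> norm (grad_k P R k)"
proof -
  have "phi A * chi_cg P A R k \<le> norm (proj (wset R k) (step P R k))"
    using cg_iterationD[OF k] by (simp add: cg_iteration_def)
  also have "\<dots> \<le> norm (grad_k P R k)"
    unfolding grad_k_eq[OF k] by (rule norm_proj_pg_step_le[OF a _ live_on_wset(1)[OF k]]) (simp add: step_def)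
  finally show ?thesis .
qed

text \<open>A group violating this would have been moved to \<open>I_small\<close>: the test there
  uses the gradient over \<open>I_cg_bar\<close>, whose norm is at least that over the working
  set.\<close>

lemma norm_group_ge:
  assumes k: "k \<in> K_cg P A R" and i: "i \<in> groups_in P (wset R k)"
  shows "kappa2 A * norm (grad_k P R k) powr p_exp A \<le> norm (proj (group P i) (iter R k))"
proof -
  let ?x = "iter R k" and ?J = "I_cg_bar P A R k"
  have "wset R k \<subseteq> I_cg P A R k"
    using cg_iterationD[OF k] by (simp add: cg_iteration_def)
  then have i': "i \<in> {1..ngroups P}" "group P i \<subseteq> ?J" "\<not> group P i \<subseteq> I_small P A R k"
    using i group_nonempty[of i] by (auto simp: groups_in_def I_cg_def)
  have "\<not> norm (proj (group P i) ?x) < kappa2 A * norm (partial_gradient ?J (objective P) ?x) powr p_exp A"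
  proof
    assume "norm (proj (group P i) ?x) < kappa2 A * norm (partial_gradient ?J (objective P) ?x) powr p_exp A"
    with i' have "group P i \<subseteq> I_small P A R k"
      unfolding I_small_def groups_in_def by blast
    with i' show False by simp
  qed
  moreover have "norm (grad_k P R k) \<le> norm (partial_gradient ?J (objective P) ?x)"
    unfolding grad_k_eq[OF k] partial_gradient_objective[OF live_on_wset(2)[OF k] diff]
    by (rule norm_proj_mono[OF live_on_wset(3)[OF k]])
  then have "kappa2 A * norm (grad_k P R k) powr p_exp A
      \<le> kappa2 A * norm (partial_gradient ?J (objective P) ?x) powr p_exp A"
    using param_bounds by (intro mult_left_mono powr_mono2) auto
  ultimately show ?thesis
    by linarith
qed

section \<open>Monotonicity and boundedness along the run\<close>

lemma cg_iteration_cases: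
  assumes "k \<in> K_cg P A R"
  obtains (zero) j where "cg_accept_zero P A R k j" "iter R (Suc k) = cg_trial P A R k j"
  | (sd) j where "cg_accept_sd P A R k j" "\<And>l. l < j \<Longrightarrow> \<not> cg_accept_sd P A R k l"
      "iter R (Suc k) = iter R k + (xi A ^ j) *\<^sub>R dir R k"
  using cg_iterationD[OF assms] unfolding cg_iteration_def cg_search_def by (elim conjE disjE) blast+

text \<open>PG descent needs a positive proximal parameter, so its bounds, monotonicity and
  membership in the level set are established together.\<close>

lemma invariants:
  "iter R k \<in> level_set P (iter R 0) \<and> 0 < alpha R k \<and> alpha R k \<le> 1"
  "objective P (iter R (Suc k)) \<le> objective P (iter R k)"
proof -
  have main: "objective P (iter R (Suc k)) \<le> objective P (iter R k)
      \<and> 0 < alpha R (Suc k) \<and> alpha R (Suc k) \<le> 1"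
    if a: "0 < alpha R k" "alpha R k \<le> 1" for k
  proof (cases "k \<in> K_cg P A R")
    case True
    have "grad_k P R k \<bullet> dir R k \<le> 0"
      using norm_dir_sq_le[OF True] mu_min
      by (smt (verit) divide_pos_pos mult_nonneg_nonneg zero_le_power2)
    then have nonpos: "eta A * xi A ^ j * (grad_k P R k \<bullet> dir R k) \<le> 0" for j
      using param_bounds by (intro mult_nonneg_nonpos) auto
    have "objective P (iter R (Suc k)) \<le> objective P (iter R k)"
      using True
    proof (cases rule: cg_iteration_cases)
      case (zero j)
      then show ?thesis
        by (simp add: cg_accept_zero_def)
    next
      case (sd j)
      then show ?thesis
        using nonpos[of j] by (simp add: cg_accept_sd_def)
    qed
    then show ?thesis
      using a cg_iterationD[OF True] by (simp add: cg_iteration_def)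
  next
    case False
    then have "pg_iteration P A R k"
      using K_cases pg_iterationD by blast
    then obtain j where j: "pg_accept P A R k j"
        "iter R (Suc k) = iter R k + (xi A ^ j) *\<^sub>R proj (wset R k) (step P R k)"
        "alpha R (Suc k) = (if j = 0 then alpha R k else zeta A * alpha R k)"
      by (auto simp: pg_iteration_def)
    have "0 \<le> eta A * xi A ^ j * (1 / alpha R k) * (norm (proj (wset R k) (step P R k)))\<^sup>2"
      using a param_bounds by simp
    then have "objective P (iter R (Suc k)) \<le> objective P (iter R k)"
      using j by (simp add: pg_accept_def)
    moreover have "0 < zeta A * alpha R k" "zeta A * alpha R k \<le> 1"
      using a param_bounds by (auto intro: mult_le_one)
    ultimately show ?thesis
      using a j(3) by simp
  qed
  have "iter R k \<in> level_set P (iter R 0) \<and> 0 < alpha R k \<and> alpha R k \<le> 1" for k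
  proof (induction k)
    case 0
    then show ?case
      using run by (simp add: level_set_def algorithm_run_def)
  next
    case (Suc k)
    then show ?case
      using main[of k] by (auto simp: level_set_def)
  qed
  then show "iter R k \<in> level_set P (iter R 0) \<and> 0 < alpha R k \<and> alpha R k \<le> 1"
    "objective P (iter R (Suc k)) \<le> objective P (iter R k)"
    using main by auto
qed

lemmas iter_in_level = invariants(1)[THEN conjunct1]
  and alpha_pos = invariants(1)[THEN conjunct2, THEN conjunct1]
  and alpha_le_1 = invariants(1)[THEN conjunct2, THEN conjunct2]
  and objective_decreasing = invariants(2)

lemma norm_step_le: "norm (step P R k) \<le> D"
  using norm_pg_step_le[OF alpha_pos[of k] alpha_le_1[of k] refl, of "iter R k"]
    grad_bound[OF iter_in_level[of k]] D(2) by (simp add: step_def)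

text \<open>\<open>norm_dir_sq_le\<close> is quadratic in the direction and Cauchy-Schwarz is linear
  in it; the gradient is bounded on the level set.\<close>

lemma norm_dir_le:
  assumes k: "k \<in> K_cg P A R"
  shows "norm (dir R k) \<le> D"
proof (cases "dir R k = 0")
  case False
  have "norm (grad_k P R k) \<le> norm (gradient (smooth P) (iter R k)) + norm (reg_grad P (iter R k))"
    unfolding grad_k_eq[OF k] by (rule order_trans[OF norm_proj_le norm_triangle_ineq])
  also have "\<dots> \<le> L_f + weight_sum P"
    by (intro add_mono grad_bound iter_in_level norm_reg_grad_le)
  finally have g: "norm (grad_k P R k) \<le> L_f + weight_sum P" .
  have "mu_min / 2 * (norm (dir R k))\<^sup>2 \<le> - (grad_k P R k \<bullet> dir R k)"
    by (rule norm_dir_sq_le[OF k])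
  also have "\<dots> \<le> norm (grad_k P R k) * norm (dir R k)"
    using norm_cauchy_schwarz[of "- grad_k P R k" "dir R k"] by simp
  also have "\<dots> \<le> (L_f + weight_sum P) * norm (dir R k)"
    by (intro mult_right_mono g) simp
  finally have "mu_min / 2 * norm (dir R k) \<le> L_f + weight_sum P"
    using False by (simp add: power2_eq_square)
  then have "norm (dir R k) \<le> 2 * (L_f + weight_sum P) / mu_min"
    using mu_min by (simp add: field_simps)
  with D(3) show ?thesis
    by simp
qed (use D in simp)

text \<open>Convexity of the regularizer passes the fraction \<open>t\<close> of the full decrease
  to a short step. The smoothness error is of order \<open>t\<^sup>2\<close> and, by the bound on
  \<open>t\<close>, consumes at most the share \<open>1 - eta A\<close>. The block \<open>I\<close>
  is arbitrary so that the full step is covered too.\<close>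

lemma pg_trial_decrease:
  assumes I: "union_of_groups P I" and t: "0 < t" "t \<le> 1" "t * alpha R k * M \<le> 1 - eta A"
  shows "objective P (iter R k + t *\<^sub>R proj I (step P R k))
           \<le> objective P (iter R k) - eta A * t * (1 / alpha R k) * (norm (proj I (step P R k)))\<^sup>2"
proof -
  let ?x = "iter R k" and ?a = "alpha R k" and ?u = "proj I (step P R k)"
  have a: "0 < ?a" by (rule alpha_pos)
  have "norm (t *\<^sub>R ?u) \<le> norm ?u"
    using t by (simp add: mult_left_le_one_le)
  then have "norm (t *\<^sub>R ?u) \<le> D"
    using norm_proj_le[of I "step P R k"] norm_step_le[of k] by linarith
  then have "smooth P (?x + t *\<^sub>R ?u) \<le> smooth P ?x + t * (gradient (smooth P) ?x \<bullet> ?u) + M * (norm (t *\<^sub>R ?u))\<^sup>2"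
    using smooth_quadratic[OF iter_in_level[of k], of "t *\<^sub>R ?u"] by simp
  moreover have "regularizer P (?x + t *\<^sub>R ?u) \<le> regularizer P ?x + t * (regularizer P (?x + ?u) - regularizer P ?x)"
    using t by (intro regularizer_convex) auto
  moreover have "t * (gradient (smooth P) ?x \<bullet> ?u + (regularizer P (?x + ?u) - regularizer P ?x))
      \<le> t * (- (1 / ?a) * (norm ?u)\<^sup>2)"
    using t a by (intro mult_left_mono pg_step_decrease I) (auto simp: step_def)
  ultimately have "objective P (?x + t *\<^sub>R ?u) \<le> objective P ?x + t * (- (1 / ?a) * (norm ?u)\<^sup>2) + M * (norm (t *\<^sub>R ?u))\<^sup>2"
    unfolding objective_def distrib_left by linarith
  moreover have "M * (norm (t *\<^sub>R ?u))\<^sup>2 \<le> (1 - eta A) * t * (1 / ?a) * (norm ?u)\<^sup>2"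
  proof -
    have "M * (norm (t *\<^sub>R ?u))\<^sup>2 = (t * ?a * M) * (t * (1 / ?a) * (norm ?u)\<^sup>2)"
      using a by (simp add: power_mult_distrib power2_eq_square)
    also have "\<dots> \<le> (1 - eta A) * (t * (1 / ?a) * (norm ?u)\<^sup>2)"
      using t a by (intro mult_right_mono) auto
    finally show ?thesis
      by simp
  qed
  ultimately show ?thesis
    by (simp add: algebra_simps)
qed

lemma pg_accept_if_small:
  assumes "k \<in> K_pg P A R" "xi A ^ j * alpha R k * M \<le> 1 - eta A"
  shows "pg_accept P A R k j"
  unfolding pg_accept_def
proof (rule pg_trial_decrease)
  show "union_of_groups P (wset R k)"
    using pg_iterationD[OF assms(1)] by (simp add: pg_iteration_def)
qed (use assms param_bounds in \<open>auto intro: power_le_one\<close>)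

text \<open>The parameter shrinks only after the full step was rejected, which requires
  \<open>alpha R k\<close> to exceed \<open>(1 - eta A) / M\<close>.\<close>

lemma alpha_ge: "min (alpha R 0) (zeta A * (1 - eta A) / M) \<le> alpha R k"
proof (induction k)
  case (Suc k)
  show ?case
  proof (cases "k \<in> K_cg P A R")
    case True
    then show ?thesis
      using Suc cg_iterationD[OF True] by (simp add: cg_iteration_def)
  next
    case False
    then have k: "k \<in> K_pg P A R"
      using K_cases by blast
    then obtain j where j: "\<And>l. l < j \<Longrightarrow> \<not> pg_accept P A R k l"
        "alpha R (Suc k) = (if j = 0 then alpha R k else zeta A * alpha R k)"
      using pg_iterationD[OF k] by (auto simp: pg_iteration_def)
    show ?thesis
    proof (cases "j = 0")
      case False
      then have "\<not> alpha R k * M \<le> 1 - eta A"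
        using pg_accept_if_small[OF k, of 0] j(1)[of 0] by auto
      then have "(1 - eta A) / M \<le> alpha R k"
        using M by (simp add: field_simps)
      then have "zeta A * ((1 - eta A) / M) \<le> zeta A * alpha R k"
        using param_bounds by (intro mult_left_mono) auto
      then show ?thesis
        using j(2) False by simp
    qed (use Suc j in simp)
  qed
qed simp

lemma pg_decrease:
  assumes k: "k \<in> K_pg P A R"
  shows "objective P (iter R (Suc k)) \<le> objective P (iter R k)
           - eta A * min 1 (xi A * (1 - eta A) / M) * (phi A * chi_pg P A R k)\<^sup>2"
proof -
  obtain j where j: "pg_accept P A R k j" "\<And>l. l < j \<Longrightarrow> \<not> pg_accept P A R k l"
      "iter R (Suc k) = iter R k + (xi A ^ j) *\<^sub>R proj (wset R k) (step P R k)"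
      and n: "phi A * chi_pg P A R k \<le> norm (proj (wset R k) (step P R k))"
    using pg_iterationD[OF k] by (auto simp: pg_iteration_def)
  have t: "min 1 (xi A * (1 - eta A) / M) \<le> xi A ^ j"
  proof (cases j)
    \<comment> \<open>The trial just before the accepted one failed, so its step size exceeds the
      threshold of \<open>pg_accept_if_small\<close>; one more factor \<open>xi A\<close> is
      lost.\<close>
    case (Suc l)
    then have "\<not> xi A ^ l * alpha R k * M \<le> 1 - eta A"
      using pg_accept_if_small[OF k] j(2) by blast
    moreover have "xi A ^ l * alpha R k * M \<le> xi A ^ l * 1 * M"
      using param_bounds M alpha_le_1 by (intro mult_right_mono mult_left_mono) auto
    ultimately have "1 - eta A \<le> xi A ^ l * M"
      by simp
    then have "(1 - eta A) / M \<le> xi A ^ l"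
      using M by (simp add: pos_divide_le_eq)
    then have "xi A * ((1 - eta A) / M) \<le> xi A * xi A ^ l"
      using param_bounds by (intro mult_left_mono) auto
    then show ?thesis
      using Suc by simp
  qed simp
  have "0 \<le> chi_pg P A R k"
    by (simp add: chi_pg_def)
  then have "(phi A * chi_pg P A R k)\<^sup>2 \<le> (norm (proj (wset R k) (step P R k)))\<^sup>2"
    using n param_bounds by (intro power_mono) auto
  moreover have "1 \<le> 1 / alpha R k"
    using alpha_pos[of k] alpha_le_1[of k] by simp
  ultimately have "eta A * min 1 (xi A * (1 - eta A) / M) * 1 * (phi A * chi_pg P A R k)\<^sup>2
      \<le> eta A * xi A ^ j * (1 / alpha R k) * (norm (proj (wset R k) (step P R k)))\<^sup>2"
    using param_bounds t M alpha_pos[of k]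
    by (intro mult_mono mult_left_mono mult_nonneg_nonneg) auto
  then show ?thesis
    using j(1,3) by (simp add: pg_accept_def)
qed

end

text \<open>\<open>LEAST\<close> over the reals is informative only if the minimum is attained: the
  roots form a nonempty closed set, by the intermediate value theorem and continuity.\<close>

lemma least_root_ge:
  fixes h :: "real \<Rightarrow> real"
  assumes cont: "continuous_on {0..} h" and b: "0 < b"
    and above: "\<And>t. 0 \<le> t \<Longrightarrow> t < b \<Longrightarrow> c < h t" and t1: "0 \<le> t1" "h t1 \<le> c"
  shows "b \<le> (LEAST t. 0 < t \<and> h t = c)"
proof -
  define S where "S = {t. 0 < t \<and> h t = c}"
  have S_ge: "b \<le> t" if "t \<in> S" for t
    using above[of t] that by (force simp: S_def)
  have "\<exists>t. 0 \<le> t \<and> t \<le> t1 \<and> h t = c"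
    using above[of 0] b t1
    by (intro IVT2' continuous_on_subset[OF cont]) (auto simp: less_imp_le)
  then obtain t where "0 \<le> t" "h t = c"
    by blast
  then have "t \<in> S"
    using above[of 0] b by (cases "t = 0") (auto simp: S_def)
  then have "S \<noteq> {}"
    by blast
  \<comment> \<open>As \<open>h 0\<close> exceeds \<open>c\<close>, the strict bound
    \<open>0 < t\<close> may be relaxed to a closed condition.\<close>
  moreover have "S = {0..} \<inter> h -` {c}"
    using above[of 0] b by (auto simp: S_def less_le)
  then have "closed S"
    by (simp add: continuous_closed_preimage[OF cont])
  moreover have bdd: "bdd_below S"
    using S_ge by (auto simp: bdd_below_def)
  ultimately have "Inf S \<in> S"
    by (intro closed_contains_Inf)
  then have "(LEAST t. 0 < t \<and> h t = c) = Inf S"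
    using cInf_lower[OF _ bdd] by (intro Least_equality) (auto simp: S_def)
  with S_ge[OF \<open>Inf S \<in> S\<close>] show ?thesis
    by simp
qed

section \<open>Acceptance in the CG search\<close>

context bounded_run begin

text \<open>The target ball has radius at most \<open>sin (theta A)\<close> times the norm of the
  group, so a distance of at least \<open>(1 - sin (theta A)) * w\<close> must be covered at speed
  at most \<open>D\<close>.\<close>

lemma tau_ge:
  assumes k: "k \<in> K_cg P A R" and w: "0 < w"
    and lower: "\<And>i. i \<in> groups_in P (wset R k) \<Longrightarrow> w \<le> norm (proj (group P i) (iter R k))"
  shows "ereal ((1 - sin (theta A)) * w / D) \<le> tau P A R k"
  unfolding tau_def
proof (rule INF_greatest)
  fix i assume i: "i \<in> groups_in P (wset R k)"
  let ?x = "proj (group P i) (iter R k)"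
  let ?h = "\<lambda>t. norm (proj (group P i) (iter R k + t *\<^sub>R dir R k))"
  define b where "b = (1 - sin (theta A)) * w / D"
  have b: "0 < b"
    using param_bounds w D by (simp add: b_def)
  have cont: "continuous_on {0..} ?h"
    by (intro continuous_intros bounded_linear.continuous_on[OF bounded_linear_proj])
  have above: "rho_bar P A R k i < ?h t" if t: "0 \<le> t" "t < b" for t
  proof -
    have "norm ?x \<le> ?h t + norm (t *\<^sub>R proj (group P i) (dir R k))"
      unfolding proj_add proj_scaleR by (metis add_diff_cancel_right' norm_triangle_ineq4)
    also have "norm (t *\<^sub>R proj (group P i) (dir R k)) \<le> t * D"
      using t norm_dir_le[OF k] norm_proj_le[of "group P i" "dir R k"]
      by (auto intro!: mult_left_mono)
    also have "t * D < b * D"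
      using t D by simp
    also have "b * D \<le> (1 - sin (theta A)) * norm ?x"
      using D param_bounds lower[OF i] by (simp add: b_def)
    finally show ?thesis
      by (simp add: rho_bar_def algebra_simps)
  qed
  show "ereal ((1 - sin (theta A)) * w / D) \<le> tau_grp P A R k i"
    unfolding tau_grp_def b_def[symmetric]
    using least_root_ge[OF cont b above] by auto
qed

text \<open>The first bound on the step keeps it below \<open>tau\<close>. By the second, the
  quadratic error is at most the share \<open>1 - eta A\<close> of the linear decrease, since
  \<open>norm_dir_sq_le\<close> compares the squared length of the direction with the slope.\<close>

lemma cg_accept_sd_if_small:
  assumes k: "k \<in> K_cg P A R" and w: "0 < w"
    and lower: "\<And>i. i \<in> groups_in P (wset R k) \<Longrightarrow> w \<le> norm (proj (group P i) (iter R k))"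
    and t: "xi A ^ j < (1 - sin (theta A)) * w / D"
      "xi A ^ j * (M + weight_sum P / (2 * w)) \<le> (1 - eta A) * (mu_min / 2)"
  shows "cg_accept_sd P A R k j"
proof -
  let ?x = "iter R k" and ?d = "dir R k" and ?g = "grad_k P R k"
  let ?C = "M + weight_sum P / (2 * w)"
  define s where "s = xi A ^ j"
  have s: "0 < s" "s \<le> 1"
    using param_bounds by (auto simp: s_def power_le_one)
  have "norm (s *\<^sub>R ?d) \<le> norm ?d"
    using s by (simp add: mult_left_le_one_le)
  then have "norm (s *\<^sub>R ?d) \<le> D"
    using norm_dir_le[OF k] by linarith
  then have "smooth P (?x + s *\<^sub>R ?d) \<le> smooth P ?x + gradient (smooth P) ?x \<bullet> (s *\<^sub>R ?d) + M * (norm (s *\<^sub>R ?d))\<^sup>2"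
    using smooth_quadratic[OF iter_in_level[of k], of "s *\<^sub>R ?d"] by linarith
  moreover have "vec_on (wset R k) (s *\<^sub>R ?d)"
    using vec_on_dir[OF k] by (simp add: vec_on_def)
  then have "regularizer P (?x + s *\<^sub>R ?d) \<le> regularizer P ?x + reg_grad P ?x \<bullet> (s *\<^sub>R ?d)
      + weight_sum P / (2 * w) * (norm (s *\<^sub>R ?d))\<^sup>2"
    by (intro regularizer_le_quadratic[OF live_on_wset(1)[OF k] _ w lower])
  moreover have "(gradient (smooth P) ?x + reg_grad P ?x) \<bullet> ?d = ?g \<bullet> ?d"
    using vec_on_dir[OF k] by (simp add: grad_k_eq[OF k] inner_proj vec_on_iff)
  then have "gradient (smooth P) ?x \<bullet> (s *\<^sub>R ?d) + reg_grad P ?x \<bullet> (s *\<^sub>R ?d) = s * (?g \<bullet> ?d)"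
    by (simp add: inner_add_left flip: distrib_left)
  moreover have "M * (norm (s *\<^sub>R ?d))\<^sup>2 + weight_sum P / (2 * w) * (norm (s *\<^sub>R ?d))\<^sup>2
      = s * (s * ?C) * (norm ?d)\<^sup>2"
    using s by (simp add: power2_eq_square algebra_simps)
  ultimately have "objective P (?x + s *\<^sub>R ?d) \<le> objective P ?x + s * (?g \<bullet> ?d) + s * (s * ?C) * (norm ?d)\<^sup>2"
    unfolding objective_def by linarith
  also have "s * (s * ?C) * (norm ?d)\<^sup>2 \<le> s * ((1 - eta A) * (mu_min / 2)) * (norm ?d)\<^sup>2"
    using t(2) s by (intro mult_right_mono mult_left_mono) (auto simp: s_def)
  also have "\<dots> = s * (1 - eta A) * (mu_min / 2 * (norm ?d)\<^sup>2)"
    by simp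
  also have "\<dots> \<le> s * (1 - eta A) * (- (?g \<bullet> ?d))"
    using s param_bounds by (intro mult_left_mono norm_dir_sq_le[OF k]) auto
  finally have "objective P (?x + s *\<^sub>R ?d) \<le> objective P ?x + eta A * s * (?g \<bullet> ?d)"
    by (simp add: algebra_simps)
  moreover have "ereal s < tau P A R k"
    using t(1) tau_ge[OF k w lower] unfolding s_def by (meson less_ereal.simps(1) less_le_trans)
  ultimately show ?thesis
    by (simp add: cg_accept_sd_def s_def)
qed

section \<open>Zero groups under CG iterations\<close>

lemma finite_zero_groups: "finite (zero_groups P x)"
  by (simp add: zero_groups_def)

lemma card_zero_groups_le: "card (zero_groups P x) \<le> ngroups P"
proof -
  have "zero_groups P x \<subseteq> {1..ngroups P}"
    by (auto simp: zero_groups_def)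
  then have "card (zero_groups P x) \<le> card {1..ngroups P}"
    by (rule card_mono[rotated]) simp
  then show ?thesis
    by simp
qed

text \<open>The working set contains no zero group, so the direction vanishes on all of
  them.\<close>

lemma proj_dir_zero_group:
  assumes k: "k \<in> K_cg P A R" and i: "i \<in> zero_groups P (iter R k)"
  shows "proj (group P i) (iter R k + t *\<^sub>R dir R k) = 0"
proof -
  have live: "live_on P (wset R k) (iter R k)"
    by (rule live_on_wset(1)[OF k])
  then have "\<not> group P i \<subseteq> wset R k"
    using i by (auto simp: live_on_def zero_groups_def groups_in_def)
  then have "proj (group P i) (dir R k) = 0"
    using live i vec_on_dir[OF k] proj_group_proj[of "wset R k" i "dir R k"]
    by (simp add: live_on_def zero_groups_def vec_on_iff)
  then show ?thesis
    using i by (simp add: proj_add proj_scaleR zero_groups_def)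
qed

lemma zero_groups_sd:
  assumes "k \<in> K_cg P A R" "iter R (Suc k) = iter R k + t *\<^sub>R dir R k"
  shows "zero_groups P (iter R k) \<subseteq> zero_groups P (iter R (Suc k))"
  using proj_dir_zero_group[OF assms(1)] by (auto simp: assms(2) zero_groups_def)

text \<open>Old zero groups persist because the direction does not touch them. Strictness comes from
  a group attaining the minimum in \<open>tau\<close>: it was nonzero and is set to zero.\<close>

lemma zero_groups_cg_trial:
  assumes k: "k \<in> K_cg P A R" and j: "cg_accept_zero P A R k j"
  shows "zero_groups P (iter R k) \<subset> zero_groups P (cg_trial P A R k j)"
proof
  let ?Z = "\<Union>{group P i | i. i \<in> groups_in P (wset R k) \<and> tau_grp P A R k i \<le> ereal (xi A ^ j)}"
  have trial: "cg_trial P A R k j = proj (- ?Z) (iter R k + (xi A ^ j) *\<^sub>R dir R k)"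
    by (simp add: cg_trial_def)
  show "zero_groups P (iter R k) \<subseteq> zero_groups P (cg_trial P A R k j)"
  proof
    fix i assume i: "i \<in> zero_groups P (iter R k)"
    have "proj (group P i) (cg_trial P A R k j)
        = proj (- ?Z) (proj (group P i) (iter R k + (xi A ^ j) *\<^sub>R dir R k))"
      unfolding trial by (simp only: proj_proj Int_commute)
    then show "i \<in> zero_groups P (cg_trial P A R k j)"
      using i proj_dir_zero_group[OF k i] by (simp add: zero_groups_def)
  qed
  have fin: "finite (groups_in P (wset R k))"
    by (simp add: groups_in_def)
  have tau: "tau P A R k \<le> ereal (xi A ^ j)"
    using j by (simp add: cg_accept_zero_def)
  have "\<exists>i\<in>groups_in P (wset R k). tau_grp P A R k i \<le> ereal (xi A ^ j)"
  proof (rule ccontr)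
    assume "\<not> ?thesis"
    then have *: "\<And>i. i \<in> groups_in P (wset R k) \<Longrightarrow> ereal (xi A ^ j) < tau_grp P A R k i"
      by (simp add: not_le)
    \<comment> \<open>An empty working set makes \<open>tau\<close> infinite; otherwise the infimum
      over finitely many groups is attained.\<close>
    have "ereal (xi A ^ j) < tau P A R k"
    proof (cases "groups_in P (wset R k) = {}")
      case True
      then show ?thesis
        by (simp add: tau_def top_ereal_def)
    next
      case False
      then have "tau P A R k \<in> tau_grp P A R k ` groups_in P (wset R k)"
        unfolding tau_def using fin by (subst Min_Inf[symmetric]) (auto intro!: Min_in)
      with * show ?thesis by auto
    qed
    with tau show False by simp
  qed
  then obtain i where i: "i \<in> groups_in P (wset R k)" "tau_grp P A R k i \<le> ereal (xi A ^ j)"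
    by blast
  then have "group P i \<subseteq> ?Z"
    by blast
  then have "group P i \<inter> - ?Z = {}"
    by blast
  then have "proj (group P i) (cg_trial P A R k j) = 0"
    unfolding trial proj_proj by simp
  then have "i \<in> zero_groups P (cg_trial P A R k j)"
    using i by (simp add: zero_groups_def groups_in_def)
  moreover have "i \<notin> zero_groups P (iter R k)"
    using live_on_wset(1)[OF k] i by (simp add: live_on_def zero_groups_def)
  ultimately show "zero_groups P (iter R k) \<noteq> zero_groups P (cg_trial P A R k j)"
    by blast
qed


text \<open>A measure of at least \<open>e\<close> bounds the gradient below, hence the group norms,
  hence the curvature above and the accepted step size below. The resulting \<delta> does not depend
  on the iteration.\<close>

lemma sd_decrease:
  assumes e: "0 < e"
  obtains \<delta> where "0 < \<delta>"
    and "\<And>k j. k \<in> K_cg P A R \<Longrightarrow> e \<le> chi_cg P A R k \<Longrightarrow> cg_accept_sd P A R k j \<Longrightarrow>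
      (\<And>l. l < j \<Longrightarrow> \<not> cg_accept_sd P A R k l) \<Longrightarrow>
      objective P (iter R k + (xi A ^ j) *\<^sub>R dir R k) \<le> objective P (iter R k) - \<delta>"
proof -
  define G where "G = phi A * e"
  define w where "w = kappa2 A * G powr p_exp A"
  define C where "C = M + weight_sum P / (2 * w)"
  \<comment> \<open>The two thresholds of \<open>cg_accept_sd_if_small\<close>; every step size
    below \<open>tm\<close> is accepted.\<close>
  define tm where "tm = min ((1 - sin (theta A)) * w / D) ((1 - eta A) * (mu_min / 2) / C)"
  define \<delta> where "\<delta> = eta A * min 1 (xi A * tm) * (G\<^sup>2 / mu_max)"
  have G: "0 < G"
    using e param_bounds by (simp add: G_def)
  then have w: "0 < w"
    using param_bounds by (simp add: w_def)
  have C: "0 < C"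
    using M w weight_sum_nonneg by (auto simp: C_def intro!: add_pos_nonneg)
  have tm: "0 < tm"
    using param_bounds w C D mu_min by (simp add: tm_def)
  have mu_max: "0 < mu_max"
    using mu_min mu_le by linarith
  have \<delta>: "0 < \<delta>"
    using param_bounds tm G mu_max by (simp add: \<delta>_def)
  have dec: "objective P (iter R k + (xi A ^ j) *\<^sub>R dir R k) \<le> objective P (iter R k) - \<delta>"
    if k: "k \<in> K_cg P A R" and chi: "e \<le> chi_cg P A R k" and j: "cg_accept_sd P A R k j"
      and first: "\<And>l. l < j \<Longrightarrow> \<not> cg_accept_sd P A R k l" for k j
  proof -
    let ?g = "grad_k P R k"
    have g: "G \<le> norm ?g"
    proof -
      have "G \<le> phi A * chi_cg P A R k"
        unfolding G_def using chi param_bounds by (intro mult_left_mono) auto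
      also have "\<dots> \<le> norm ?g"
        by (rule phi_chi_cg_le_norm_grad_k[OF k alpha_pos alpha_le_1])
      finally show ?thesis .
    qed
    have lower: "w \<le> norm (proj (group P i) (iter R k))" if "i \<in> groups_in P (wset R k)" for i
    proof -
      have "w \<le> kappa2 A * norm ?g powr p_exp A"
        unfolding w_def using param_bounds g G by (intro mult_left_mono powr_mono2) auto
      also have "\<dots> \<le> norm (proj (group P i) (iter R k))"
        by (rule norm_group_ge[OF k that])
      finally show ?thesis .
    qed
    have t: "min 1 (xi A * tm) \<le> xi A ^ j"
    proof (cases j)
      \<comment> \<open>The previous trial was rejected and hence not below \<open>tm\<close>;
        backtracking costs one factor \<open>xi A\<close>.\<close>
      case (Suc l)
      have "tm \<le> xi A ^ l"
      proof (rule ccontr)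
        assume "\<not> tm \<le> xi A ^ l"
        then have "xi A ^ l < (1 - sin (theta A)) * w / D" "xi A ^ l \<le> (1 - eta A) * (mu_min / 2) / C"
          by (auto simp: tm_def)
        moreover from this(2) have "xi A ^ l * C \<le> (1 - eta A) * (mu_min / 2)"
          using C by (simp add: pos_le_divide_eq)
        ultimately have "cg_accept_sd P A R k l"
          by (intro cg_accept_sd_if_small[OF k w lower]) (auto simp: C_def)
        then show False
          using first Suc by blast
      qed
      then have "xi A * tm \<le> xi A * xi A ^ l"
        using param_bounds by (intro mult_left_mono) auto
      then show ?thesis
        using Suc by simp
    qed simp
    have "\<delta> \<le> eta A * xi A ^ j * ((norm ?g)\<^sup>2 / mu_max)"
      unfolding \<delta>_def using param_bounds t tm g G mu_max
      by (intro mult_mono mult_left_mono divide_right_mono power_mono) auto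
    also have "\<dots> \<le> eta A * xi A ^ j * (- (?g \<bullet> dir R k))"
      using grad_k_inner_dir_le[OF k] param_bounds by (intro mult_left_mono) auto
    finally show ?thesis
      using j by (simp add: cg_accept_sd_def)
  qed
  from \<delta> dec show ?thesis
    by (rule that)
qed

text \<open>
  A zeroing CG step need not decrease the objective, but it enlarges the set of zero groups, and
  only a PG step can shrink that set.  So \<open>objective - c * card zero_groups\<close>, with \<open>c\<close> small
  enough for the decrease of a PG step to pay for the loss of all zero groups, decreases by a
  fixed amount in each iteration for as long as the optimality measure stays above \<open>e\<close>.
\<close>

lemma small_chi:
  assumes bdd: "bdd_below (range (objective P))" and e: "0 < e"
  shows "\<exists>k. max (chi_cg P A R k) (chi_pg P A R k) < e"
proof (rule ccontr)
  assume "\<not> ?thesis"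
  then have chi: "e \<le> max (chi_cg P A R k) (chi_pg P A R k)" for k
    by (meson not_less)
  obtain \<delta>1 where \<delta>1: "0 < \<delta>1" and sd_dec: "\<And>k j. k \<in> K_cg P A R \<Longrightarrow> e \<le> chi_cg P A R k \<Longrightarrow>
      cg_accept_sd P A R k j \<Longrightarrow> (\<And>l. l < j \<Longrightarrow> \<not> cg_accept_sd P A R k l) \<Longrightarrow>
      objective P (iter R k + (xi A ^ j) *\<^sub>R dir R k) \<le> objective P (iter R k) - \<delta>1"
    using sd_decrease[OF e] by blast
  define \<delta>2 where "\<delta>2 = eta A * min 1 (xi A * (1 - eta A) / M) * (phi A * e)\<^sup>2"
  have \<delta>2: "0 < \<delta>2"
    using param_bounds M e by (simp add: \<delta>2_def)
  \<comment> \<open>The guaranteed decrease is cut into \<open>ngroups P + 1\<close> shares: one for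
    each zero group that may be lost and one left as net decrease.\<close>
  define c where "c = min \<delta>1 \<delta>2 / (real (ngroups P) + 1)"
  have c: "0 < c"
    using \<delta>1 \<delta>2 by (simp add: c_def)
  have "c * (real (ngroups P) + 1) = min \<delta>1 \<delta>2"
    by (simp add: c_def add_nonneg_eq_0_iff)
  then have c_n: "c * real (ngroups P) + c \<le> \<delta>1" "c * real (ngroups P) + c \<le> \<delta>2"
    by (auto simp: distrib_left)
  define Z where "Z k = real (card (zero_groups P (iter R k)))" for k
  have Z: "0 \<le> c * Z k" "c * Z k \<le> c * real (ngroups P)" for k
    using c card_zero_groups_le by (auto simp: Z_def)
  define \<Phi> where "\<Phi> k = objective P (iter R k) - c * Z k" for k
  have step: "\<Phi> (Suc k) \<le> \<Phi> k - c" for k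
  proof (cases "k \<in> K_cg P A R")
    case True
    then have chi_cg: "e \<le> chi_cg P A R k"
      using chi[of k] by (simp add: K_cg_def)
    from True show ?thesis
    proof (cases rule: cg_iteration_cases)
      case (zero j)
      then have "card (zero_groups P (iter R k)) < card (zero_groups P (iter R (Suc k)))"
        using zero_groups_cg_trial[OF True zero(1)] finite_zero_groups by (simp add: psubset_card_mono)
      then have "Z k + 1 \<le> Z (Suc k)"
        by (simp add: Z_def)
      then have "c * (Z k + 1) \<le> c * Z (Suc k)"
        using c by (intro mult_left_mono) auto
      then show ?thesis
        using objective_decreasing[of k] by (simp add: \<Phi>_def distrib_left)
    next
      case (sd j)
      then have "Z k \<le> Z (Suc k)"
        using card_mono[OF finite_zero_groups zero_groups_sd[OF True sd(3)]] by (simp add: Z_def)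
      then have "c * Z k \<le> c * Z (Suc k)"
        using c by (intro mult_left_mono) auto
      moreover have "objective P (iter R (Suc k)) \<le> objective P (iter R k) - \<delta>1"
        unfolding sd(3) by (rule sd_dec[OF True chi_cg sd(1,2)])
      ultimately show ?thesis
        using c_n(1) Z(1)[of k] Z(2)[of k] by (simp add: \<Phi>_def)
    qed
  next
    case False
    then have k: "k \<in> K_pg P A R" and chi_pg: "e \<le> chi_pg P A R k"
      using chi[of k] by (auto simp: K_cg_def K_pg_def)
    have "\<delta>2 \<le> eta A * min 1 (xi A * (1 - eta A) / M) * (phi A * chi_pg P A R k)\<^sup>2"
      unfolding \<delta>2_def using param_bounds M e chi_pg by (intro mult_left_mono power_mono) auto
    then have "objective P (iter R (Suc k)) \<le> objective P (iter R k) - \<delta>2"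
      using pg_decrease[OF k] by linarith
    then show ?thesis
      using c_n(2) Z(1)[of "Suc k"] Z(2)[of k] by (simp add: \<Phi>_def)
  qed
  have \<Phi>_le: "\<Phi> k \<le> \<Phi> 0 - real k * c" for k
  proof (induction k)
    case (Suc k)
    then show ?case
      using step[of k] by (simp add: distrib_right)
  qed simp
  obtain b where b: "\<And>x. b \<le> objective P x"
    using bdd by (auto simp: bdd_below_def)
  \<comment> \<open>By then \<Phi> would be below its lower bound
    \<open>b - c * ngroups P\<close>.\<close>
  obtain k where k: "\<Phi> 0 - b + c * real (ngroups P) < real k * c"
    using reals_Archimedean3[OF c] by blast
  show False
    using \<Phi>_le[of k] k b[of "iter R k"] Z(2)[of k] by (simp add: \<Phi>_def)
qed

text \<open>A hypothetical PG trial over all coordinates, not necessarily made by the algorithm,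
  still has value at least \<open>F_star\<close>; its guaranteed decrease therefore cannot exceed
  the gap.\<close>

lemma step_sq_le_gap:
  assumes "\<And>x. F_star \<le> objective P x"
  shows "eta A * min 1 ((1 - eta A) / M) * (norm (step P R k))\<^sup>2 \<le> objective P (iter R k) - F_star"
proof -
  define t where "t = min 1 ((1 - eta A) / M)"
  have t: "0 < t" "t \<le> 1" "t * M \<le> 1 - eta A"
  proof -
    have "t \<le> (1 - eta A) / M"
      by (simp add: t_def)
    then show "t * M \<le> 1 - eta A"
      using M by (simp add: pos_le_divide_eq)
  qed (use param_bounds M in \<open>auto simp: t_def\<close>)
  have "t * alpha R k * M \<le> t * 1 * M"
    using t M alpha_le_1 by (intro mult_right_mono mult_left_mono) auto
  then have "t * alpha R k * M \<le> 1 - eta A"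
    using t(3) by linarith
  then have "objective P (iter R k + t *\<^sub>R step P R k)
      \<le> objective P (iter R k) - eta A * t * (1 / alpha R k) * (norm (step P R k))\<^sup>2"
    using pg_trial_decrease[OF union_of_groups_UNIV t(1,2), of k] t by simp
  moreover have "eta A * t * 1 * (norm (step P R k))\<^sup>2 \<le> eta A * t * (1 / alpha R k) * (norm (step P R k))\<^sup>2"
    using alpha_pos[of k] alpha_le_1[of k] param_bounds t by (intro mult_right_mono mult_left_mono) auto
  ultimately show ?thesis
    using assms[of "iter R k + t *\<^sub>R step P R k"] by (simp add: t_def)
qed

lemma norm_step_le_chi: "norm (step P R k) \<le> 2 * max (chi_cg P A R k) (chi_pg P A R k)"
  using norm_le_proj_add_Compl[of "step P R k" "I_cg P A R k"]
  by (simp add: chi_cg_def chi_pg_def I_pg_def)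

lemma chi_le_norm_step: "max (chi_pg P A R k) (chi_cg P A R k) \<le> norm (step P R k)"
  by (simp add: chi_cg_def chi_pg_def norm_proj_le)

end

section \<open>Convergence\<close>

text \<open>Near \<open>x\<close> the function differs from its tangent by order
  \<open>t\<^sup>2\<close>, while convexity bounds the increment by \<open>t\<close> times the full
  one; dividing by \<open>t\<close> leaves the claim up to a multiple of \<open>t\<close>.\<close>

lemma convex_ge_tangent:
  fixes h :: "real^'n::finite \<Rightarrow> real"
  assumes conv: "convex_on UNIV h" and tcd: "twice_cont_differentiable h"
  shows "h x + gradient h x \<bullet> v \<le> h (x + v)"
proof -
  obtain M where lip: "M-lipschitz_on (cball x (norm v)) (gradient h)"
    using twice_cont_differentiable_lipschitz_on_cball[OF tcd] by blast
  have "gradient h x \<bullet> v - (h (x + v) - h x) \<le> 0"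
  proof (rule nonpos_if_le_linear)
    fix t :: real assume t: "0 < t" "t \<le> 1"
    have "\<bar>h (x + t *\<^sub>R v) - h x - gradient h x \<bullet> (t *\<^sub>R v)\<bar> \<le> M * (norm (t *\<^sub>R v))\<^sup>2"
      using tcd t
      by (intro quadratic_bound_of_lipschitz_gradient[OF _ lip])
         (auto simp: twice_cont_differentiable_def dist_norm mult_left_le_one_le)
    moreover have "h (x + t *\<^sub>R v) \<le> (1 - t) * h x + t * h (x + v)"
      using convex_onD[OF conv, of t x "x + v"] t by (simp add: algebra_simps)
    ultimately have "t * (gradient h x \<bullet> v - (h (x + v) - h x)) \<le> t * (t * (M * (norm v)\<^sup>2))"
      using t by (simp add: power2_eq_square algebra_simps)
    then show "gradient h x \<bullet> v - (h (x + v) - h x) \<le> t * (M * (norm v)\<^sup>2)"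
      using t by simp
  qed
  then show ?thesis
    by simp
qed

context group_problem begin

lemma objective_quadratic_growth:
  assumes "strongly_convex (smooth P)" and min: "is_arg_min (objective P) (\<lambda>x. True) x_star"
  obtains m where "0 < m" and "\<And>x. m * (norm (x - x_star))\<^sup>2 \<le> objective P x - objective P x_star"
proof -
  obtain m where m: "0 < m" "\<And>x y t. 0 \<le> t \<Longrightarrow> t \<le> 1 \<Longrightarrow> smooth P ((1 - t) *\<^sub>R x + t *\<^sub>R y)
      \<le> (1 - t) * smooth P x + t * smooth P y - m / 2 * t * (1 - t) * (norm (x - y))\<^sup>2"
    using assms(1) unfolding strongly_convex_def by blast
  have "m / 4 * (norm (x - x_star))\<^sup>2 \<le> objective P x - objective P x_star" for x
  proof -
    define Q where "Q = m * (norm (x - x_star))\<^sup>2"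
    \<comment> \<open>At the midpoint strong convexity gains \<open>Q / 8\<close> over the average
      of the end values, yet the objective there is not below the minimum.\<close>
    define y where "y = x + (1 / 2) *\<^sub>R (x_star - x)"
    have "y = (1 - 1 / 2) *\<^sub>R x + (1 / 2) *\<^sub>R x_star"
      by (simp add: y_def vec_eq_iff field_simps)
    then have "smooth P y \<le> 1 / 2 * smooth P x + 1 / 2 * smooth P x_star - Q / 8"
      using m(2)[of "1 / 2" x x_star] by (simp add: Q_def)
    moreover have "regularizer P y \<le> regularizer P x + 1 / 2 * (regularizer P x_star - regularizer P x)"
      using regularizer_convex[of "1 / 2" x "x_star - x"] by (simp add: y_def)
    moreover have "objective P x_star \<le> objective P y"
      using min by (auto simp: is_arg_min_def not_less)
    ultimately have "Q / 4 \<le> objective P x - objective P x_star"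
      unfolding objective_def right_diff_distrib by (simp add: field_simps)
    then show ?thesis
      by (simp add: Q_def)
  qed
  then show ?thesis
    using m(1) by (intro that[of "m / 4"]) auto
qed

text \<open>The tangent of the smooth part at \<open>x\<close> is added to the subgradient
  inequality at \<open>x + s\<close>. The terms linear in \<open>w - x\<close> with the gradient
  cancel, and every remaining term carries a factor \<open>norm s\<close>.\<close>

lemma objective_gap_le_pg_step:
  assumes tangent: "\<And>v. smooth P x + gradient (smooth P) x \<bullet> v \<le> smooth P (x + v)"
    and a: "0 < a" and s: "s = pg_step P x a"
  shows "objective P x - objective P w
    \<le> (norm (gradient (smooth P) x) + weight_sum P + 1 / a * (norm (w - x) + norm s)) * norm s"
proof -
  let ?g = "gradient (smooth P) x"
  have "regularizer P (x + s) - (?g + (1 / a) *\<^sub>R s) \<bullet> (w - (x + s)) \<le> regularizer P w"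
    by (rule pg_step_subgradient[OF a s])
  moreover have "smooth P x + ?g \<bullet> (w - x) \<le> smooth P w"
    using tangent[of "w - x"] by simp
  moreover have "(?g + (1 / a) *\<^sub>R s) \<bullet> (w - (x + s)) = ?g \<bullet> (w - x) - ?g \<bullet> s + 1 / a * (s \<bullet> (w - (x + s)))"
    by (simp add: inner_add_left inner_add_right inner_diff_right diff_divide_distrib add_divide_distrib)
  moreover have "regularizer P x - regularizer P (x + s) \<le> weight_sum P * norm s"
    using regularizer_diff_le[of x "x + s"] by simp
  moreover have "- (?g \<bullet> s) \<le> norm ?g * norm s"
    using norm_cauchy_schwarz[of "- ?g" s] by simp
  moreover have "1 / a * (s \<bullet> (w - (x + s))) \<le> 1 / a * ((norm (w - x) + norm s) * norm s)"
  proof (intro mult_left_mono)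
    have "s \<bullet> (w - (x + s)) \<le> norm s * norm (w - x - s)"
      using norm_cauchy_schwarz[of s "w - (x + s)"] by (simp add: diff_diff_eq)
    also have "\<dots> \<le> norm s * (norm (w - x) + norm s)"
      by (intro mult_left_mono norm_triangle_ineq4) auto
    finally show "s \<bullet> (w - (x + s)) \<le> (norm (w - x) + norm s) * norm s"
      by (simp add: mult.commute)
  qed (use a in simp)
  ultimately have "objective P x - objective P w
      \<le> norm ?g * norm s + weight_sum P * norm s + 1 / a * ((norm (w - x) + norm s) * norm s)"
    unfolding objective_def by linarith
  then show ?thesis
    by (simp add: distrib_right)
qed

end

theorem theorem4p2:
  fixes P :: "('n::finite) problem" and A :: params and R :: "'n run"
    and L_f L mu_min mu_max :: real and x_star :: "real^'n"
  assumes "valid_problem P" and "valid_params A"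
    and "algorithm_run P A R"
    and "convex_on UNIV (smooth P)" and "cont_differentiable (smooth P)"
    and "\<forall>x \<in> level_set P (iter R 0). norm (gradient (smooth P) x) \<le> L_f"
    and "L-lipschitz_on (level_set P (iter R 0)) (gradient (smooth P))"
    and "bdd_below (range (objective P))"
    and "\<forall>k. max (chi_cg P A R k) (chi_pg P A R k) > 0"
    and "0 < mu_min" and "mu_min \<le> mu_max"
    and "\<forall>k \<in> K_cg P A R. \<forall>v. vec_on (wset R k) v \<longrightarrow>
           mu_min * (norm v)\<^sup>2 \<le> v \<bullet> (Hmat R k *v v) \<and>
           v \<bullet> (Hmat R k *v v) \<le> mu_max * (norm v)\<^sup>2"
    and "twice_cont_differentiable (smooth P)" and "strongly_convex (smooth P)"
    and "is_arg_min (objective P) (\<lambda>x. True) x_star"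
    and "\<exists>U M. open U \<and> x_star \<in> U \<and> M-lipschitz_on U (hessian (smooth P))"
    and "\<forall>i \<in> {1..ngroups P}. proj (group P i) x_star = 0 \<longrightarrow>
           norm (proj (group P i) (gradient (smooth P) x_star)) < weight P i"
    and "eta A < 1 / 2"
    and "\<forall>\<^sub>F k in sequentially.
           (k \<in> K_cg P A R \<longrightarrow> wset R k = I_cg P A R k) \<and>
           (k \<in> K_pg P A R \<longrightarrow> wset R k = I_pg P A R k)"
    and "\<forall>\<^sub>F k in sequentially. k \<in> K_cg P A R \<longrightarrow>
           Hmat R k = partial_hessian (wset R k) (objective P) (iter R k)"
  shows "iter R \<longlonglongrightarrow> x_star \<and>
         (\<lambda>k. max (chi_pg P A R k) (chi_cg P A R k)) \<longlonglongrightarrow> 0"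
proof -
  interpret group_problem P
    by (rule group_problem.intro) (rule assms(1))
  note convex = assms(4) and tcd = assms(13)
  have min: "objective P x_star \<le> objective P x" for x
    using assms(15) by (auto simp: is_arg_min_def not_less)
  obtain m where m: "0 < m"
    and growth: "\<And>x. m * (norm (x - x_star))\<^sup>2 \<le> objective P x - objective P x_star"
    using objective_quadratic_growth[OF assms(14,15)] by blast
  \<comment> \<open>By quadratic growth the level set lies in the ball of radius \<open>b\<close>
    about \<open>x_star\<close>.\<close>
  define b where "b = sqrt ((objective P (iter R 0) - objective P x_star) / m)"
  have level: "norm (x - x_star) \<le> b" if "x \<in> level_set P (iter R 0)" for x
  proof -
    have "m * (norm (x - x_star))\<^sup>2 \<le> objective P (iter R 0) - objective P x_star"
      using growth[of x] that by (simp add: level_set_def)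
    then show ?thesis
      unfolding b_def using m by (intro real_le_rsqrt) (simp add: field_simps)
  qed
  have b: "0 \<le> b"
    using m min by (simp add: b_def)
  define D where "D = max 1 (max (L_f + weight_sum P) (2 * (L_f + weight_sum P) / mu_min))"
  \<comment> \<open>Trial points may leave the level set, but by at most \<open>D\<close>; this
    larger ball contains them all.\<close>
  obtain M' where lip: "M'-lipschitz_on (cball x_star (b + D)) (gradient (smooth P))"
    using twice_cont_differentiable_lipschitz_on_cball[OF tcd] by blast
  define M where "M = max 1 M'"
  interpret bounded_run P A R L_f mu_min mu_max M D
  proof
    fix x v :: "real^'n"
    assume x: "x \<in> level_set P (iter R 0)" and v: "norm v \<le> D"
    have "norm (x + v - x_star) \<le> norm (x - x_star) + norm v"
      by (rule order_trans[OF eq_refl norm_triangle_ineq[of "x - x_star" v]]) (simp add: algebra_simps)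
    then have "x \<in> cball x_star (b + D)" "x + v \<in> cball x_star (b + D)"
      using level[OF x] v order_trans[OF norm_ge_zero v]
      by (auto simp: dist_norm norm_minus_commute[of x_star])
    then have "\<bar>smooth P (x + v) - smooth P x - gradient (smooth P) x \<bullet> v\<bar> \<le> M' * (norm v)\<^sup>2"
      using tcd
      by (intro quadratic_bound_of_lipschitz_gradient[OF _ lip])
         (auto simp: twice_cont_differentiable_def)
    also have "\<dots> \<le> M * (norm v)\<^sup>2"
      by (intro mult_right_mono) (auto simp: M_def)
    finally show "\<bar>smooth P (x + v) - smooth P x - gradient (smooth P) x \<bullet> v\<bar> \<le> M * (norm v)\<^sup>2" .
  qed (use assms in \<open>auto simp: D_def M_def twice_cont_differentiable_def\<close>)

  define gap where "gap k = objective P (iter R k) - objective P x_star" for k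
  have gap_nonneg: "0 \<le> gap k" for k
    using min by (simp add: gap_def)
  have "decseq gap"
    using objective_decreasing by (intro decseq_SucI) (simp add: gap_def)
  define a where "a = min (alpha R 0) (zeta A * (1 - eta A) / M)"
  have a: "0 < a"
    using alpha_pos[of 0] param_bounds M by (simp add: a_def)
  \<comment> \<open>Bounds the coefficient in \<open>objective_gap_le_pg_step\<close> for all
    iterations at once.\<close>
  define K where "K = L_f + weight_sum P + 1 / a * (b + D)"
  have gap_le: "gap k \<le> K * norm (step P R k)" for k
  proof -
    have "gap k \<le> (norm (gradient (smooth P) (iter R k)) + weight_sum P
        + 1 / alpha R k * (norm (x_star - iter R k) + norm (step P R k))) * norm (step P R k)"
      unfolding gap_def
      by (intro objective_gap_le_pg_step convex_ge_tangent[OF convex tcd] alpha_pos) (simp add: step_def)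
    also have "\<dots> \<le> K * norm (step P R k)"
    proof (intro mult_right_mono)
      have "norm (gradient (smooth P) (iter R k)) \<le> L_f"
        by (intro grad_bound iter_in_level)
      moreover have "1 / alpha R k * (norm (x_star - iter R k) + norm (step P R k)) \<le> 1 / a * (b + D)"
        using a alpha_ge[of k] level[OF iter_in_level[of k]] norm_step_le[of k]
        by (intro mult_mono divide_left_mono add_mono)
           (auto simp: a_def norm_minus_commute alpha_pos less_imp_le[OF alpha_pos])
      ultimately show "norm (gradient (smooth P) (iter R k)) + weight_sum P
          + 1 / alpha R k * (norm (x_star - iter R k) + norm (step P R k)) \<le> K"
        by (simp add: K_def)
    qed simp
    finally show ?thesis .
  qed
  have K: "0 < K"
  proof -
    have "0 \<le> L_f"
      using grad_bound[OF iter_in_level[of 0]] norm_ge_zero order_trans by blast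
    then show ?thesis
      using weight_sum_nonneg a b D(1) by (simp add: K_def add_nonneg_pos)
  qed
  have gap: "gap \<longlonglongrightarrow> 0"
  proof (rule LIMSEQ_I)
    fix e :: real assume e: "0 < e"
    \<comment> \<open>One such index suffices because the gap is monotone; the factor
      \<open>2\<close> comes from \<open>norm_step_le_chi\<close>.\<close>
    obtain k where k: "max (chi_cg P A R k) (chi_pg P A R k) < e / (2 * K)"
      using small_chi[OF assms(8), of "e / (2 * K)"] e K by auto
    have "K * norm (step P R k) \<le> K * (2 * max (chi_cg P A R k) (chi_pg P A R k))"
      using K by (intro mult_left_mono norm_step_le_chi) auto
    also have "\<dots> < K * (2 * (e / (2 * K)))"
      using k K by (intro mult_strict_left_mono) auto
    also have "\<dots> = e"
      using K by simp
    finally have "gap k < e"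
      using gap_le[of k] by linarith
    then have "norm (gap n - 0) < e" if "k \<le> n" for n
      using decseqD[OF \<open>decseq gap\<close> that] gap_nonneg[of n] by simp
    then show "\<exists>n0. \<forall>n\<ge>n0. norm (gap n - 0) < e"
      by blast
  qed
  \<comment> \<open>Serves both limits: the distance to \<open>x_star\<close> and the length of the
    PG step.\<close>
  have norm_tendsto: "X \<longlonglongrightarrow> (0::real)"
    if c: "0 < c" and X: "\<And>k. 0 \<le> X k" "\<And>k. c * (X k)\<^sup>2 \<le> gap k" for X c
  proof (rule tendsto_sandwich[OF _ _ tendsto_const])
    show "(\<lambda>k. sqrt (gap k / c)) \<longlonglongrightarrow> 0"
      using tendsto_real_sqrt[OF tendsto_divide[OF gap tendsto_const, of c]] c by simp
    have "X k \<le> sqrt (gap k / c)" for k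
      using X(2)[of k] c by (intro real_le_rsqrt) (simp add: field_simps)
    then show "\<forall>\<^sub>F k in sequentially. X k \<le> sqrt (gap k / c)"
      by simp
  qed (use X in simp)
  have "(\<lambda>k. norm (iter R k - x_star)) \<longlonglongrightarrow> 0"
    using growth by (intro norm_tendsto[OF m]) (auto simp: gap_def)
  then have "iter R \<longlonglongrightarrow> x_star"
    by (simp add: LIM_zero_cancel tendsto_norm_zero_iff)
  moreover have step: "(\<lambda>k. norm (step P R k)) \<longlonglongrightarrow> 0"
  proof (rule norm_tendsto)
    show "0 < eta A * min 1 ((1 - eta A) / M)"
      using param_bounds M by simp
  qed (use step_sq_le_gap[OF min] in \<open>auto simp: gap_def\<close>)
  have "(\<lambda>k. max (chi_pg P A R k) (chi_cg P A R k)) \<longlonglongrightarrow> 0"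
  proof (rule tendsto_sandwich[OF _ _ tendsto_const step])
    show "\<forall>\<^sub>F k in sequentially. max (chi_pg P A R k) (chi_cg P A R k) \<le> norm (step P R k)"
      using chi_le_norm_step by simp
    show "\<forall>\<^sub>F k in sequentially. 0 \<le> max (chi_pg P A R k) (chi_cg P A R k)"
      by (simp add: chi_pg_def le_max_iff_disj)
  qed
  ultimately show ?thesis
    by blast
qed

end
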